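(* Let $b\ge 1$ be an integer, let $K>12$, let $p=p(n)=\frac{\ln^{K} n}{n}$, and let $G\sim \mathcal{G}_{n,p}$. Then a.a.s. $G$ is such that in the $(1:b)$ Maker-Breaker perfect matching game $\mathcal{M}_n(G)$ played on the edge set of $G$, Maker has a strategy to win within $\frac{n}{2}+o(n)$ moves.
   Context: $\mathcal{G}_{n,p}$ is the binomial random graph on $n$ labelled vertices, in which each pair of vertices is an edge independently with probability $p$. $\ln^{K}n=(\ln n)^{K}$. "A.a.s." means with probability tending to $1$ as $n\to\infty$. The parameters $b,K$ are fixed and $o(n)$ denotes a (deterministic) function $g(n)$ with $g(n)/n\to 0$. Let $X$ be a finite set (the board) and $\mathcal{F}\subseteq 2^X$ (the winning sets). In the $(a:b)$ Maker-Breaker (weak) game $(X,\mathcal{F})$, two players play in rounds; in each round Maker claims $a$ previously unclaimed elements of $X$ and Breaker claims $b$ previously unclaimed elements of $X$ (or all remaining ones if fewer are left). Maker wins as soon as he has claimed all elements of some $F\in\mathcal{F}$; if all elements of $X$ are claimed without this happening, Breaker wins. Breaker moves first and Maker is the second player. The number of moves is the number of Maker's turns. In the perfect matching game $\mathcal{M}_n(G)$ on a graph $G$ with $n$ vertices, the board is $E(G)$ and the winning sets are all sets of $\lfloor n/2\rfloor$ pairwise disjoint (independent) edges of $G$. *)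

theory Defs
  imports "HOL-Probability.Probability"
begin

text \<open>
  Maker-Breaker games. A round is a pair consisting of the set claimed by Breaker (who moves
  first) and the set that Maker claims in reply; a history is the list of rounds played so far.
\<close>

type_synonym 'x history = "('x set \<times> 'x set) list"

definition breaker_claimed :: "'x history \<Rightarrow> 'x set" where
  "breaker_claimed h = \<Union>(fst ` set h)"

definition maker_claimed :: "'x history \<Rightarrow> 'x set" where
  "maker_claimed h = \<Union>(snd ` set h)"

definition unclaimed :: "'x set \<Rightarrow> 'x history \<Rightarrow> 'x set" where
  "unclaimed X h = X - (breaker_claimed h \<union> maker_claimed h)"

text \<open>
  A player with bias \<open>k\<close> facing the set \<open>U\<close> of unclaimed elements claims exactly \<open>k\<close> of them, or
  all of \<open>U\<close> if fewer are left. Once the board is exhausted the only legal move is the empty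
  one, so that plays can be continued indefinitely without any effect.
\<close>

definition legal_move :: "nat \<Rightarrow> 'x set \<Rightarrow> 'x set \<Rightarrow> bool" where
  "legal_move k U S \<longleftrightarrow> S \<subseteq> U \<and> card S = min k (card U)"

text \<open>
  A strategy for Maker may depend on the whole past and on Breaker's current move.
\<close>

type_synonym 'x strategy = "'x history \<Rightarrow> 'x set \<Rightarrow> 'x set"

definition maker_strategy :: "nat \<Rightarrow> 'x set \<Rightarrow> 'x strategy \<Rightarrow> bool" where
  "maker_strategy a X \<sigma> \<longleftrightarrow> (\<forall>h B. legal_move a (unclaimed X h - B) (\<sigma> h B))"

text \<open>
  The first rounds of the play in which Breaker makes the moves \<open>\<beta> 0, \<beta> 1, \<dots>\<close> and Maker
  follows \<open>\<sigma>\<close>.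
\<close>

primrec play :: "'x strategy \<Rightarrow> (nat \<Rightarrow> 'x set) \<Rightarrow> nat \<Rightarrow> 'x history" where
  "play \<sigma> \<beta> 0 = []"
| "play \<sigma> \<beta> (Suc i) = play \<sigma> \<beta> i @ [(\<beta> i, \<sigma> (play \<sigma> \<beta> i) (\<beta> i))]"

definition legal_breaker_moves ::
    "nat \<Rightarrow> 'x set \<Rightarrow> 'x strategy \<Rightarrow> (nat \<Rightarrow> 'x set) \<Rightarrow> bool" where
  "legal_breaker_moves b X \<sigma> \<beta> \<longleftrightarrow>
     (\<forall>i. legal_move b (unclaimed X (play \<sigma> \<beta> i)) (\<beta> i))"

text \<open>
  In the \<open>(a : b)\<close> game on the finite board \<open>X\<close> with winning sets \<open>\<F>\<close>, Maker, as the second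
  player, can force a win within \<open>t\<close> of his own turns (each round contains one of them).
\<close>

definition maker_wins_within ::
    "nat \<Rightarrow> nat \<Rightarrow> 'x set \<Rightarrow> 'x set set \<Rightarrow> real \<Rightarrow> bool" where
  "maker_wins_within a b X \<F> t \<longleftrightarrow>
     (\<exists>\<sigma>. maker_strategy a X \<sigma> \<and>
        (\<forall>\<beta>. legal_breaker_moves b X \<sigma> \<beta> \<longrightarrow>
           (\<exists>i. real i \<le> t \<and> (\<exists>F\<in>\<F>. F \<subseteq> maker_claimed (play \<sigma> \<beta> i)))))"

text \<open>
  Graphs on the vertex set \<open>{..<n}\<close> are given by their edge sets, an edge being a two-element
  set of vertices.
\<close>

definition all_edges :: "nat \<Rightarrow> nat set set" where
  "all_edges n = {e. e \<subseteq> {..<n} \<and> card e = 2}"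

text \<open>
  \<^const>\<open>bernoulli_pmf\<close> clamps \<open>p\<close> to \<open>[0, 1]\<close>.
\<close>

definition random_graph :: "nat \<Rightarrow> real \<Rightarrow> nat set set pmf" where
  "random_graph n p =
     map_pmf (\<lambda>f. {e \<in> all_edges n. f e}) (Pi_pmf (all_edges n) False (\<lambda>_. bernoulli_pmf p))"

definition perfect_matching_sets :: "nat \<Rightarrow> nat set set \<Rightarrow> nat set set set" where
  "perfect_matching_sets n E = {M. M \<subseteq> E \<and> card M = n div 2 \<and> pairwise disjnt M}"

end

theory Submission
  imports Defs "HOL-Real_Asymp.Real_Asymp"
begin

text \<open>
  Maker splits the \<open>N = 2 \<lfloor>n/2\<rfloor>\<close> vertices into a small reserve \<open>R\<close> of \<open>4s\<close> vertices, where
  \<open>s \<approx> n / (ln n)\<^bsup>K-2\<^esup>\<close>, and the rest \<open>W\<close>. Greedily he builds a matching inside \<open>W\<close> until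
  exactly \<open>4s\<close> vertices of \<open>W\<close> are left over; he then matches these to \<open>R\<close> without
  caring about speed. The edges of the matching inside \<open>W\<close> cost at most \<open>n/2\<close> moves, and the task of the second
  phase can be solved slowly because a vertex has only \<open>O((ln n)\<^sup>2)\<close>
  neighbours in \<open>R\<close>: the left-over vertices and \<open>R\<close> span \<open>O(s (ln n)\<^sup>2) = o(n)\<close> edges altogether,
  and Maker cannot make more moves than there are edges.

  The bipartite game between left-over vertices and \<open>R\<close> is won in the manner of Beck's criterion.
  By Hall's theorem Maker needs an edge between \<open>S\<close> and \<open>T\<close> for all pairs with
  \<open>|S| + |T| = 4s + 1\<close>, that is, he has to hit every edge set between such \<open>S\<close> and \<open>T\<close>; a pair not
  yet hit has a weight that grows by a factor \<open>q\<close> slightly above \<open>1\<close> with every edge Breaker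
  claims in it, and reaches \<open>1\<close> if Breaker claims all of it. Two dangers remain, because Breaker
  can do damage during the first phase and because the set of left-over vertices depends on the
  play.

  First, Breaker might spoil the edges to \<open>R\<close> of a vertex that is not yet matched. Therefore such
  a vertex \<open>v\<close> has a weight too, \<open>q\<^bsup>d-D\<^esup>\<close> where \<open>d\<close> is its degree in Breaker's graph and
  \<open>q\<^sup>D = 8n\<close>, and the two kinds of weights are added up to one potential. In each move Maker
  removes the heaviest thing: the heaviest vertex, by matching it, or the heaviest edge towards
  \<open>R\<close>, by claiming it. As Breaker's \<open>b\<close> edges then increase the potential by at most what Maker
  removed, the potential stays below \<open>1\<close>, so that all these vertices have Breaker degree less
  than \<open>D = O(ln n)\<close>. A vertex that has no free edge to another unmatched vertex cannot be matched
  in this way; such a vertex is activated, which means that it is kept for the second phase and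
  that Maker plays on its edges to \<open>R\<close> from now on, its own weight being dropped. In the potential an inactive vertex counts in a
  pair \<open>(S, T)\<close> as if Breaker had already taken \<open>D\<close> of its edges, so that activating a vertex never
  increases the potential. Since there are enough edges between any two disjoint sets of \<open>s\<close>
  vertices, at most \<open>s\<close> vertices get activated in the first phase.

  Second, a small set \<open>T \<subseteq> R\<close> might have no neighbours in an arbitrary set of left-over vertices.
  Therefore \<open>2s\<close> vertices of \<open>W\<close>, the core \<open>C\<close>, are active from the beginning. If \<open>T\<close> is small,
  then \<open>S\<close> contains almost all of \<open>C\<close>, and so it is enough to consider pairs with \<open>S \<subseteq> C\<close>.

  All that is required of the graph is that the initial potential and two similar sums of
  exponentials of edge counts are small. Their expectations in the random graph have a simple
  closed form, so Markov's inequality finishes the proof (\<open>prob_maker_wins_ge\<close>); the deterministic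
  part is \<open>position_progress\<close>.
\<close>

section \<open>Winning from a position\<close>

text \<open>
  Whether Maker can still win depends only on the two sets of claimed elements, not on the order
  of the moves. This is the value of the position in which Breaker has just moved and Maker has
  \<open>k\<close> moves left; it avoids all bookkeeping of histories in the later induction.
\<close>

primrec forces_win ::
    "nat \<Rightarrow> 'x set \<Rightarrow> 'x set set \<Rightarrow> nat \<Rightarrow> 'x set \<Rightarrow> 'x set \<Rightarrow> bool" where
  "forces_win b X \<F> 0 M B \<longleftrightarrow> (\<exists>F\<in>\<F>. F \<subseteq> M)"
| "forces_win b X \<F> (Suc k) M B \<longleftrightarrow> (\<exists>F\<in>\<F>. F \<subseteq> M) \<or>
     (\<exists>m. legal_move 1 (X - (B \<union> M)) m \<and>
        (\<forall>S. legal_move b (X - (B \<union> (M \<union> m))) S \<longrightarrow> forces_win b X \<F> k (M \<union> m) (B \<union> S)))"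

lemma legal_move_exists: "\<exists>S. legal_move k U S"
  unfolding legal_move_def by (metis min.cobounded2 obtain_subset_with_card_n)

text \<open>
  Maker's strategy picks, in any history, a move that keeps the position won with the remaining
  number of moves, if there is one. The legality of a strategy is demanded for arbitrary
  histories, including impossible ones, hence the fallback to an arbitrary legal move.
\<close>

lemma maker_wins_within_if_forces_win:
  assumes first: "\<And>S. legal_move b X S \<Longrightarrow> forces_win b X \<F> k {} S"
    and t: "real k \<le> t"
  shows "maker_wins_within 1 b X \<F> t"
proof -
  define good where "good h B m \<longleftrightarrow> legal_move 1 (unclaimed X h - B) m \<and>
     (\<forall>S. legal_move b (X - (breaker_claimed h \<union> B \<union> (maker_claimed h \<union> m))) S \<longrightarrow>
        forces_win b X \<F> (k - Suc (length h)) (maker_claimed h \<union> m) (breaker_claimed h \<union> B \<union> S))"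
    for h B m
  define \<sigma> where "\<sigma> h B = (if \<exists>m. good h B m then SOME m. good h B m
     else SOME m. legal_move 1 (unclaimed X h - B) m)" for h B
  have good_\<sigma>: "good h B (\<sigma> h B)" if "\<exists>m. good h B m" for h B
    using that unfolding \<sigma>_def by (simp add: someI_ex)
  have legal: "legal_move 1 (unclaimed X h - B) (\<sigma> h B)" for h B
  proof (cases "\<exists>m. good h B m")
    case True
    then have "good h B (\<sigma> h B)" by (rule good_\<sigma>)
    then show ?thesis by (simp add: good_def)
  next
    case False
    then show ?thesis unfolding \<sigma>_def using someI_ex[OF legal_move_exists] by (simp only: if_False)
  qed
  have "\<exists>i. real i \<le> t \<and> (\<exists>F\<in>\<F>. F \<subseteq> maker_claimed (play \<sigma> \<beta> i))"
    if \<beta>: "legal_breaker_moves b X \<sigma> \<beta>" for \<beta>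
  proof -
    let ?h = "play \<sigma> \<beta>"
    have unclaimed_Diff: "unclaimed X h - S = X - (breaker_claimed h \<union> S \<union> maker_claimed h)" for h S
      by (auto simp: unclaimed_def)
    have claimed_Suc: "maker_claimed (?h (Suc i)) = maker_claimed (?h i) \<union> \<sigma> (?h i) (\<beta> i)"
        "breaker_claimed (?h (Suc i)) = breaker_claimed (?h i) \<union> \<beta> i" for i
      by (auto simp: breaker_claimed_def maker_claimed_def)
    have len: "length (?h i) = i" for i by (induction i) auto
    have "(\<exists>j\<le>i. \<exists>F\<in>\<F>. F \<subseteq> maker_claimed (?h j)) \<or>
        forces_win b X \<F> (k - i) (maker_claimed (?h i)) (breaker_claimed (?h i) \<union> \<beta> i)"
      if "i \<le> k" for i
      using that
    proof (induction i)
      case 0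
      have "legal_move b X (\<beta> 0)"
        using \<beta>[unfolded legal_breaker_moves_def, rule_format, of 0]
        by (simp add: unclaimed_def breaker_claimed_def maker_claimed_def)
      then show ?case using first by (simp add: breaker_claimed_def maker_claimed_def)
    next
      case (Suc i)
      show ?case
      proof (cases "\<exists>j\<le>i. \<exists>F\<in>\<F>. F \<subseteq> maker_claimed (?h j)")
        case True
        then show ?thesis using le_Suc_eq by blast
      next
        case False
        then have "forces_win b X \<F> (k - i) (maker_claimed (?h i))
            (breaker_claimed (?h i) \<union> \<beta> i)"
          using Suc.IH Suc.prems by (meson Suc_leD)
        moreover have "k - i = Suc (k - Suc i)"
          using Suc.prems by simp
        ultimately have "forces_win b X \<F> (Suc (k - Suc i)) (maker_claimed (?h i))
            (breaker_claimed (?h i) \<union> \<beta> i)"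
          by simp
        then obtain m where "good (?h i) (\<beta> i) m"
          using False unfolding forces_win.simps(2) good_def len unclaimed_Diff
          by blast
        then have "good (?h i) (\<beta> i) (\<sigma> (?h i) (\<beta> i))"
          by (intro good_\<sigma> exI)
        moreover have
          "legal_move b (X - (breaker_claimed (?h i) \<union> \<beta> i \<union>
              (maker_claimed (?h i) \<union> \<sigma> (?h i) (\<beta> i)))) (\<beta> (Suc i))"
          using \<beta>[unfolded legal_breaker_moves_def, rule_format, of "Suc i"]
          by (simp only: unclaimed_def claimed_Suc)
        ultimately show ?thesis
          unfolding good_def len claimed_Suc by blast
      qed
    qed
    from this[of k] obtain j where j: "j \<le> k" "\<exists>F\<in>\<F>. F \<subseteq> maker_claimed (?h j)"
      unfolding diff_self_eq_0 forces_win.simps(1) by blast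
    have "real j \<le> t" using j(1) t by linarith
    with j(2) show ?thesis by blast
  qed
  then show ?thesis
    unfolding maker_wins_within_def maker_strategy_def using legal by blast
qed

lemma maker_wins_within_mono:
  "maker_wins_within a b X \<F> t \<Longrightarrow> t \<le> t' \<Longrightarrow> maker_wins_within a b X \<F> t'"
  unfolding maker_wins_within_def by (meson order_trans)

section \<open>Hall's theorem\<close>

text \<open>
  The argument of Halmos and Vaughan: if a nonempty proper subset is tight, it is matched within
  its own neighbourhood, and the rest can be matched outside of that neighbourhood; if no such
  subset is tight, one element may be matched arbitrarily.
\<close>

lemma hall_injection:
  assumes "finite A" "\<And>x. x \<in> A \<Longrightarrow> finite (N x)"
    and "\<And>J. J \<subseteq> A \<Longrightarrow> card J \<le> card (\<Union>(N ` J))"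
  shows "\<exists>f. inj_on f A \<and> (\<forall>x\<in>A. f x \<in> N x)"
  using assms
proof (induction "card A" arbitrary: A N rule: less_induct)
  case less
  show ?case
  proof (cases "\<exists>J. J \<noteq> {} \<and> J \<subset> A \<and> card J = card (\<Union>(N ` J))")
    case True
    then obtain J where J: "J \<noteq> {}" "J \<subset> A" "card J = card (\<Union>(N ` J))" by blast
    have finJ: "finite J" using J(2) less.prems(1) finite_subset by blast
    have finNJ: "finite (\<Union>(N ` J))" using J(2) less.prems(2) finJ by blast
    have "card J < card A" using J(2) less.prems(1) by (rule psubset_card_mono[rotated])
    then have "\<exists>f. inj_on f J \<and> (\<forall>x\<in>J. f x \<in> N x)"
      by (rule less.hyps) (use J(2) less.prems finJ in \<open>blast+\<close>)
    then obtain f where f: "inj_on f J" "\<And>x. x \<in> J \<Longrightarrow> f x \<in> N x" by blast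
    have "\<exists>g. inj_on g (A - J) \<and> (\<forall>x\<in>A - J. g x \<in> N x - \<Union>(N ` J))"
    proof (rule less.hyps)
      show "card (A - J) < card A"
        using J(1,2) less.prems(1) by (intro psubset_card_mono) auto
      fix I assume I: "I \<subseteq> A - J"
      have finI: "finite I" using I less.prems(1) finite_subset by blast
      have finNI: "finite (\<Union>(N ` I))" using I less.prems(2) finI by blast
      have "card I + card J = card (I \<union> J)" using I finI finJ by (subst card_Un_disjoint) auto
      also have "\<dots> \<le> card (\<Union>(N ` (I \<union> J)))" using I J(2) by (intro less.prems(3)) auto
      also have "\<Union>(N ` (I \<union> J)) = \<Union>((\<lambda>x. N x - \<Union>(N ` J)) ` I) \<union> \<Union>(N ` J)" by auto
      also have "card \<dots> \<le> card (\<Union>((\<lambda>x. N x - \<Union>(N ` J)) ` I)) + card (\<Union>(N ` J))"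
        by (rule card_Un_le)
      finally show "card I \<le> card (\<Union>((\<lambda>x. N x - \<Union>(N ` J)) ` I))" using J(3) by simp
    qed (use less.prems in auto)
    then obtain g where g: "inj_on g (A - J)" "\<And>x. x \<in> A - J \<Longrightarrow> g x \<in> N x - \<Union>(N ` J)" by blast
    let ?h = "\<lambda>x. if x \<in> J then f x else g x"
    have "inj_on ?h A"
    proof (rule inj_onI)
      fix x y assume xy: "x \<in> A" "y \<in> A" "?h x = ?h y"
      consider "x \<in> J" "y \<in> J" | "x \<notin> J" "y \<notin> J" | "x \<in> J" "y \<notin> J" | "x \<notin> J" "y \<in> J" by blast
      then show "x = y"
      proof cases
        case 1 then show ?thesis using f(1) xy by (auto dest: inj_onD)
      next
        case 2 then show ?thesis using g(1) xy by (auto dest: inj_onD)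
      next
        case 3 then show ?thesis using f(2)[of x] g(2)[of y] xy by auto
      next
        case 4 then show ?thesis using f(2)[of y] g(2)[of x] xy by auto
      qed
    qed
    moreover have "\<forall>x\<in>A. ?h x \<in> N x" using f(2) g(2) by auto
    ultimately show ?thesis by blast
  next
    case no_tight: False
    show ?thesis
    proof (cases "A = {}")
      case True
      then show ?thesis by simp
    next
      case nonempty: False
      then obtain a where a: "a \<in> A" by blast
      have "card {a} \<le> card (\<Union>(N ` {a}))" using a by (intro less.prems(3)) auto
      then obtain y where y: "y \<in> N a" by (fastforce simp: card_le_Suc_iff)
      have "\<exists>g. inj_on g (A - {a}) \<and> (\<forall>x\<in>A - {a}. g x \<in> N x - {y})"
      proof (rule less.hyps)
        show "card (A - {a}) < card A" using a less.prems(1) by (intro card_Diff1_less)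
        fix I assume I: "I \<subseteq> A - {a}"
        show "card I \<le> card (\<Union>((\<lambda>x. N x - {y}) ` I))"
        proof (cases "I = {}")
          case False
          then have "card I \<noteq> card (\<Union>(N ` I))" using no_tight I a by blast
          moreover have "card I \<le> card (\<Union>(N ` I))" using I by (intro less.prems(3)) auto
          moreover have "\<Union>((\<lambda>x. N x - {y}) ` I) = \<Union>(N ` I) - {y}" by auto
          ultimately show ?thesis by (auto simp: card_Diff_singleton_if)
        qed simp
      qed (use less.prems in auto)
      then obtain g where g: "inj_on g (A - {a})" "\<And>x. x \<in> A - {a} \<Longrightarrow> g x \<in> N x - {y}" by blast
      have "inj_on (g(a := y)) A"
        using g by (fastforce simp: inj_on_def)
      moreover have "\<forall>x\<in>A. (g(a := y)) x \<in> N x" using g y by auto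
      ultimately show ?thesis by blast
    qed
  qed
qed

section \<open>Edges between two vertex sets\<close>

definition between :: "'a set \<Rightarrow> 'a set \<Rightarrow> 'a set set" where
  "between S T = (\<lambda>(x, y). {x, y}) ` (S \<times> T)"

lemma in_between_iff: "e \<in> between S T \<longleftrightarrow> (\<exists>x\<in>S. \<exists>y\<in>T. e = {x, y})"
  by (auto simp: between_def)

lemma between_mono: "S \<subseteq> S' \<Longrightarrow> T \<subseteq> T' \<Longrightarrow> between S T \<subseteq> between S' T'"
  by (auto simp: between_def)

lemma card_between:
  assumes "S \<inter> T = {}"
  shows "card (between S T) = card S * card T"
proof -
  have "inj_on (\<lambda>(x, y). {x, y}) (S \<times> T)"
    using assms by (auto simp: inj_on_def doubleton_eq_iff)
  then show ?thesis unfolding between_def by (simp add: card_image card_cartesian_product)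
qed

lemma card_Int_between_le_sum:
  assumes "finite S"
  shows "real (card (E \<inter> between S T)) \<le> (\<Sum>x\<in>S. real (card (E \<inter> between {x} T)))"
proof -
  have "E \<inter> between S T = (\<Union>x\<in>S. E \<inter> between {x} T)"
    unfolding between_def by auto
  then have "card (E \<inter> between S T) \<le> (\<Sum>x\<in>S. card (E \<inter> between {x} T))"
    using card_UN_le[OF assms, of "\<lambda>x. E \<inter> between {x} T"] by (simp only:)
  then show ?thesis by (simp flip: of_nat_sum)
qed

section \<open>The potential\<close>

text \<open>
  These pairs witness every violation of Hall's condition between a set \<open>A\<close> with
  \<open>C \<subseteq> A \<subseteq> W\<close>, \<open>|A| = 4s\<close> and the set \<open>R\<close> with \<open>|R| = 4s\<close>. The pairs of the second kind serve the
  sets \<open>S\<close> of more than \<open>3s\<close> vertices: there \<open>T\<close> has at most \<open>s\<close> elements, and the many possible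
  choices of \<open>S\<close> would spoil a union bound over all \<open>S \<subseteq> W\<close>, whereas the part of \<open>S\<close> in the core
  misses fewer than \<open>|T|\<close> elements of \<open>C\<close>.
\<close>

definition hall_pairs :: "'a set \<Rightarrow> 'a set \<Rightarrow> 'a set \<Rightarrow> nat \<Rightarrow> ('a set \<times> 'a set) set" where
  "hall_pairs W R C s =
     {(S, T). S \<subseteq> W \<and> T \<subseteq> R \<and> 1 \<le> card S \<and> card S \<le> 3 * s \<and> card S + card T = 4 * s + 1} \<union>
     {(S, T). S \<subseteq> C \<and> T \<subseteq> R \<and> 1 \<le> card T \<and> card T \<le> s \<and> card S + card T = 2 * s + 1}"

text \<open>
  One turn of Breaker: the weight \<open>w i\<close> gets multiplied by \<open>q\<close> for every element of his move \<open>S\<close>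
  that lies in \<open>H i\<close>. If the weight affected by a single element is at most \<open>2 m\<close>, linearising
  \<open>q\<^sup>j\<close> for \<open>j \<le> b\<close> shows that the total increases by at most \<open>b (q - 1) q\<^sup>b \<cdot> 2 m \<le> m\<close>.
\<close>

lemma sum_growth_le:
  fixes q m :: real and w :: "'i \<Rightarrow> real"
  assumes fin: "finite I" "finite S" and b: "card S \<le> b"
    and q: "1 \<le> q" "real b * (q - 1) * q ^ b \<le> 1 / 2"
    and w: "\<And>i. i \<in> I \<Longrightarrow> 0 \<le> w i"
    and m: "0 \<le> m" "\<And>e. e \<in> S \<Longrightarrow> (\<Sum>i | i \<in> I \<and> e \<in> H i. w i) \<le> 2 * m"
  shows "(\<Sum>i\<in>I. w i * q ^ card (S \<inter> H i)) \<le> (\<Sum>i\<in>I. w i) + m"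
proof -
  have pow: "q ^ j \<le> 1 + real j * ((q - 1) * q ^ b)" if "j \<le> b" for j
    using that
  proof (induction j)
    case (Suc j)
    have "q ^ Suc j = q ^ j + (q - 1) * q ^ j" by (simp add: algebra_simps)
    moreover have "(q - 1) * q ^ j \<le> (q - 1) * q ^ b"
      using Suc.prems q(1) by (intro mult_left_mono power_increasing) auto
    ultimately show ?case using Suc by (simp add: algebra_simps)
  qed simp
  have "w i * q ^ card (S \<inter> H i) \<le> w i + (q - 1) * q ^ b * (\<Sum>e\<in>S. if e \<in> H i then w i else 0)"
    if i: "i \<in> I" for i
  proof -
    have "card (S \<inter> H i) \<le> b" using b fin(2) by (meson Int_lower1 card_mono order_trans)
    then have "w i * q ^ card (S \<inter> H i) \<le> w i * (1 + real (card (S \<inter> H i)) * ((q - 1) * q ^ b))"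
      using pow w[OF i] by (intro mult_left_mono) auto
    moreover have "(\<Sum>e\<in>S. if e \<in> H i then w i else 0) = real (card (S \<inter> H i)) * w i"
      using fin(2) by (simp add: sum.If_cases)
    ultimately show ?thesis by (simp add: algebra_simps)
  qed
  then have "(\<Sum>i\<in>I. w i * q ^ card (S \<inter> H i)) \<le>
      (\<Sum>i\<in>I. w i + (q - 1) * q ^ b * (\<Sum>e\<in>S. if e \<in> H i then w i else 0))"
    by (intro sum_mono)
  also have "\<dots> = (\<Sum>i\<in>I. w i) +
      (q - 1) * q ^ b * (\<Sum>e\<in>S. \<Sum>i\<in>I. if e \<in> H i then w i else 0)"
    by (simp add: sum.distrib sum_distrib_left sum.swap[of _ S I])
  also have "(\<Sum>e\<in>S. \<Sum>i\<in>I. if e \<in> H i then w i else 0) =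
      (\<Sum>e\<in>S. \<Sum>i | i \<in> I \<and> e \<in> H i. w i)"
    using fin(1) by (simp add: sum.inter_filter)
  also have "(q - 1) * q ^ b * \<dots> \<le> (q - 1) * q ^ b * (\<Sum>e\<in>S. 2 * m)"
    using m(2) q(1) by (intro mult_left_mono sum_mono) auto
  also have "\<dots> \<le> (q - 1) * q ^ b * (real b * (2 * m))"
    using b q(1) m(1) by (intro mult_left_mono) (auto intro!: mult_right_mono)
  also have "\<dots> = (real b * (q - 1) * q ^ b) * (2 * m)" by simp
  also have "\<dots> \<le> 1 / 2 * (2 * m)"
    using q(2) m(1) by (intro mult_right_mono) auto
  finally show ?thesis by simp
qed

text \<open>
  The pseudorandom properties that Maker's strategy relies on. The last one bounds the initial
  potential by \<open>1/2\<close>, and since \<open>q\<^sup>b \<le> 2\<close>, it is still less than \<open>1\<close> after Breaker's first move.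
\<close>

locale matching_board =
  fixes E :: "'a set set" and W R C :: "'a set" and s b L :: nat and q D :: real
  assumes finite_W: "finite W" and finite_R: "finite R" and W_R: "W \<inter> R = {}" and C_W: "C \<subseteq> W"
    and finite_E: "finite E" and card_edge: "\<And>e. e \<in> E \<Longrightarrow> card e = 2"
    and card_R: "card R = 4 * s" and card_C: "card C = 2 * s"
    and W_size: "4 * s \<le> card W" "even (card W)"
    and q_gt_1: "1 < q" and q_step: "real b * (q - 1) * q ^ b \<le> 1 / 2" and q_pow: "q ^ b \<le> 2"
    and few_edges: "\<And>A. A \<subseteq> W \<Longrightarrow> card A \<le> 4 * s \<Longrightarrow> card (E \<inter> between A R) \<le> L"
    and spread: "\<And>Z U. Z \<subseteq> W \<Longrightarrow> U \<subseteq> W \<Longrightarrow> Z \<inter> U = {} \<Longrightarrow> card Z = s \<Longrightarrow> card U = s \<Longrightarrow>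
       \<exists>z\<in>Z. D \<le> card (E \<inter> between {z} U)"
    and start: "real (card W) * q powr (- D) + (\<Sum>(S, T)\<in>hall_pairs W R C s.
       q powr (D * card (S - C) - card (E \<inter> between S T))) < 1 / 2"
begin

definition vertex_weight :: "'a set set \<Rightarrow> 'a \<Rightarrow> real" where
  "vertex_weight B v = q powr (real (card {e \<in> B. v \<in> e}) - D)"

text \<open>
  As long as Maker has no edge between \<open>S\<close> and \<open>T\<close>, the exponent is \<open>-f\<close> where \<open>f\<close> is the number of
  edges between \<open>S\<close> and \<open>T\<close> which are free, except that for a vertex of \<open>U\<close> the number of edges
  taken by Breaker is replaced with its upper bound \<open>D\<close>.
\<close>

definition pair_weight :: "'a set set \<Rightarrow> 'a set \<Rightarrow> 'a set \<Rightarrow> 'a set \<times> 'a set \<Rightarrow> real" where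
  "pair_weight B A U = (\<lambda>(S, T). q powr (D * card (S \<inter> U) - card (E \<inter> between S T)
     + card (B \<inter> between (S \<inter> A) T)))"

definition live :: "'a set set \<Rightarrow> 'a set \<Rightarrow> 'a set \<Rightarrow> ('a set \<times> 'a set) set" where
  "live M A U = {(S, T) \<in> hall_pairs W R C s. S \<subseteq> A \<union> U \<and> M \<inter> between S T = {}}"

definition potential :: "'a set set \<Rightarrow> 'a set set \<Rightarrow> 'a set \<Rightarrow> 'a set \<Rightarrow> real" where
  "potential M B A U = (\<Sum>v\<in>U. vertex_weight B v) + (\<Sum>x\<in>live M A U. pair_weight B A U x)"

text \<open>
  The invariant that holds whenever it is Maker's turn. \<open>A\<close> is the set of active vertices, \<open>U\<close> the
  set of inactive unmatched ones, and \<open>P\<close> is Maker's matching on the rest of \<open>W\<close>. The first phase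
  lasts while \<open>A \<union> U\<close> has more than \<open>4s\<close> elements. Throughout it an activated vertex has fewer
  than \<open>D\<close> edges to \<open>U\<close>, as this was so when it got activated and \<open>U\<close> has only shrunk.
\<close>

definition position :: "'a set set \<Rightarrow> 'a set set \<Rightarrow> 'a set \<Rightarrow> 'a set \<Rightarrow> bool" where
  "position M B A U \<longleftrightarrow> C \<subseteq> A \<and> A \<union> U \<subseteq> W \<and> A \<inter> U = {} \<and>
     M \<subseteq> E \<and> B \<subseteq> E \<and> M \<inter> B = {} \<and> (\<forall>e\<in>M. e \<inter> U = {}) \<and>
     (\<exists>P\<subseteq>M. pairwise disjnt P \<and> \<Union>P = W - A - U) \<and>
     card A \<le> 4 * s \<and> 4 * s \<le> card A + card U \<and> even (card A + card U) \<and>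
     (4 * s < card A + card U \<longrightarrow>
        card (A - C) \<le> s \<and> (\<forall>z\<in>A - C. card (E \<inter> between {z} U) < D)) \<and>
     potential M B A U < 1"

text \<open>
  Only edges at active vertices of \<open>S\<close> matter here: what Breaker takes at an inactive vertex is
  covered by the estimate \<open>D\<close> and leaves the pair weights unchanged.
\<close>

definition pairs_through :: "'a set set \<Rightarrow> 'a set \<Rightarrow> 'a set \<Rightarrow> 'a set \<Rightarrow> ('a set \<times> 'a set) set" where
  "pairs_through M A U e = {(S, T) \<in> live M A U. e \<in> between (S \<inter> A) T}"

definition edge_weight :: "'a set set \<Rightarrow> 'a set set \<Rightarrow> 'a set \<Rightarrow> 'a set \<Rightarrow> 'a set \<Rightarrow> real" where
  "edge_weight M B A U e = (\<Sum>x\<in>pairs_through M A U e. pair_weight B A U x)"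

lemma hall_pairs_subset: "(S, T) \<in> hall_pairs W R C s \<Longrightarrow> S \<subseteq> W \<and> T \<subseteq> R"
  using C_W by (auto simp: hall_pairs_def)

lemma finite_hall_pairs: "finite (hall_pairs W R C s)"
proof (rule finite_subset)
  show "hall_pairs W R C s \<subseteq> Pow W \<times> Pow R" using hall_pairs_subset by auto
qed (simp add: finite_W finite_R)

lemma finite_live: "finite (live M A U)"
  by (rule finite_subset[OF _ finite_hall_pairs]) (auto simp: live_def)

lemma finite_pairs_through: "finite (pairs_through M A U e)"
  by (rule finite_subset[OF _ finite_live]) (auto simp: pairs_through_def)

lemma vertex_weight_pos: "0 < vertex_weight B v"
  using q_gt_1 by (simp add: vertex_weight_def)

lemma pair_weight_pos: "0 < pair_weight B A U x"
  using q_gt_1 by (simp add: pair_weight_def split: prod.splits)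

lemma potential_breaker_le:
  assumes S: "S \<subseteq> E - (M \<union> B)" "card S \<le> b" and U: "finite U" and B: "B \<subseteq> E" and g: "0 \<le> g"
    and bound: "\<And>e. e \<in> S \<Longrightarrow> (\<Sum>v\<in>e \<inter> U. vertex_weight B v) + edge_weight M B A U e \<le> 2 * g"
  shows "potential M (B \<union> S) A U \<le> potential M B A U + g"
proof -
  \<comment> \<open>Vertices and pairs become the two parts of one index set.\<close>
  define I where "I = U <+> live M A U"
  define w where "w = case_sum (vertex_weight B) (pair_weight B A U)"
  define H where "H = case_sum (\<lambda>v. {e. v \<in> e}) (\<lambda>(S, T). between (S \<inter> A) T)"
  have fin: "finite S" "finite B" using S(1) B finite_E finite_subset by blast+
  have SB: "B \<inter> S = {}" using S(1) by blast
  have wv: "vertex_weight (B \<union> S) v = vertex_weight B v * q ^ card (S \<inter> {e. v \<in> e})" for v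
  proof -
    have "{e \<in> B \<union> S. v \<in> e} = {e \<in> B. v \<in> e} \<union> (S \<inter> {e. v \<in> e})" by auto
    then have "card {e \<in> B \<union> S. v \<in> e} = card {e \<in> B. v \<in> e} + card (S \<inter> {e. v \<in> e})"
      using fin SB by (simp, subst card_Un_disjoint) auto
    then show ?thesis using q_gt_1
      by (simp add: vertex_weight_def powr_add[symmetric] powr_realpow[symmetric] algebra_simps)
  qed
  have wp: "pair_weight (B \<union> S) A U (S', T) =
      pair_weight B A U (S', T) * q ^ card (S \<inter> between (S' \<inter> A) T)" for S' T
  proof -
    have "card ((B \<union> S) \<inter> between (S' \<inter> A) T) =
        card (B \<inter> between (S' \<inter> A) T) + card (S \<inter> between (S' \<inter> A) T)"
      using fin SB by (simp only: Int_Un_distrib2, subst card_Un_disjoint) auto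
    then show ?thesis using q_gt_1
      by (simp add: pair_weight_def powr_add[symmetric] powr_realpow[symmetric] algebra_simps)
  qed
  have "potential M (B \<union> S) A U = (\<Sum>i\<in>I. w i * q ^ card (S \<inter> H i))"
    unfolding potential_def I_def
    by (simp add: sum.Plus U finite_live wv w_def H_def o_def)
      (auto intro!: sum.cong simp: wp split: prod.splits)
  also have "\<dots> \<le> (\<Sum>i\<in>I. w i) + g"
  proof (rule sum_growth_le[OF _ fin(1) S(2) _ q_step])
    show "finite I" unfolding I_def using U finite_live by simp
    show "0 \<le> w i" if "i \<in> I" for i
      by (cases i) (auto simp: w_def intro: less_imp_le[OF vertex_weight_pos] less_imp_le[OF pair_weight_pos])
    fix e assume e: "e \<in> S"
    have "{i \<in> I. e \<in> H i} = (e \<inter> U) <+> pairs_through M A U e"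
      by (rule set_eqI, case_tac x) (auto simp: I_def H_def pairs_through_def)
    then have "(\<Sum>i | i \<in> I \<and> e \<in> H i. w i) =
        (\<Sum>v\<in>e \<inter> U. vertex_weight B v) + edge_weight M B A U e"
      using U finite_pairs_through by (simp add: sum.Plus w_def edge_weight_def o_def)
    then show "(\<Sum>i | i \<in> I \<and> e \<in> H i. w i) \<le> 2 * g" using bound[OF e] by simp
  qed (use q_gt_1 g in auto)
  also have "(\<Sum>i\<in>I. w i) = potential M B A U"
    unfolding potential_def I_def by (simp add: sum.Plus U finite_live w_def o_def)
  finally show ?thesis .
qed

lemma vertex_weight_le_potential:
  assumes "finite U" "v \<in> U"
  shows "vertex_weight B v \<le> potential M B A U"
proof -
  have "vertex_weight B v \<le> (\<Sum>v\<in>U. vertex_weight B v)"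
    using assms by (intro member_le_sum) (auto intro: less_imp_le[OF vertex_weight_pos])
  moreover have "0 \<le> (\<Sum>x\<in>live M A U. pair_weight B A U x)"
    by (intro sum_nonneg less_imp_le[OF pair_weight_pos])
  ultimately show ?thesis by (simp add: potential_def)
qed

lemma pair_weight_le_potential:
  assumes "x \<in> live M A U"
  shows "pair_weight B A U x \<le> potential M B A U"
proof -
  have "pair_weight B A U x \<le> (\<Sum>x\<in>live M A U. pair_weight B A U x)"
    using assms finite_live by (intro member_le_sum) (auto intro: less_imp_le[OF pair_weight_pos])
  moreover have "0 \<le> (\<Sum>v\<in>U. vertex_weight B v)"
    by (intro sum_nonneg less_imp_le[OF vertex_weight_pos])
  ultimately show ?thesis by (simp add: potential_def)
qed

lemma positionD:
  assumes "position M B A U"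
  shows "C \<subseteq> A" "A \<union> U \<subseteq> W" "A \<inter> U = {}" "M \<subseteq> E" "B \<subseteq> E" "M \<inter> B = {}"
    "\<forall>e\<in>M. e \<inter> U = {}" "\<exists>P\<subseteq>M. pairwise disjnt P \<and> \<Union>P = W - A - U"
    "card A \<le> 4 * s" "4 * s \<le> card A + card U" "even (card A + card U)"
    "4 * s < card A + card U \<longrightarrow>
        card (A - C) \<le> s \<and> (\<forall>z\<in>A - C. card (E \<inter> between {z} U) < D)"
    "potential M B A U < 1"
  using assms unfolding position_def by - (elim conjE, assumption)+

lemma position_finite:
  assumes "position M B A U"
  shows "finite A" "finite U" "finite M" "finite B"
  using positionD(2,4,5)[OF assms] finite_W finite_E by (auto intro: finite_subset)

lemma breaker_degree_less:
  assumes "position M B A U" "v \<in> U"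
  shows "card {e \<in> B. v \<in> e} < D"
proof -
  have "vertex_weight B v < 1"
    using vertex_weight_le_potential[OF position_finite(2) assms(2), OF assms(1), of B M A]
    using positionD(13)[OF assms(1)] by linarith
  then show ?thesis unfolding vertex_weight_def
    using q_gt_1 ge_one_powr_ge_zero[of q "real (card {e \<in> B. v \<in> e}) - D"] by linarith
qed

text \<open>
  Activating \<open>v\<close> exchanges the pessimistic estimate \<open>D\<close> in the pair weights for the smaller true
  number of edges taken by Breaker. In the first phase a stuck vertex has lost all its edges to
  \<open>U\<close> to Breaker, so it has fewer than \<open>D\<close> of them; were there already \<open>s\<close> activated vertices, they
  and \<open>s\<close> vertices of \<open>U\<close> would contradict the spread of the edges of the graph.
\<close>

lemma position_activate:
  assumes pos: "position M B A U" and v: "v \<in> U"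
    and stuck: "4 * s = card A + card U \<or> (\<forall>y\<in>U - {v}. {v, y} \<notin> E - (M \<union> B))"
  shows "position M B (insert v A) (U - {v})"
proof -
  note fin = position_finite[OF pos]
  have p: "C \<subseteq> A" "A \<union> U \<subseteq> W" "A \<inter> U = {}" "M \<subseteq> E" "B \<subseteq> E" "\<And>e. e \<in> M \<Longrightarrow> e \<inter> U = {}"
    "4 * s < card A + card U \<Longrightarrow> card (A - C) \<le> s"
    "\<And>z. 4 * s < card A + card U \<Longrightarrow> z \<in> A - C \<Longrightarrow> card (E \<inter> between {z} U) < D"
    "4 * s \<le> card A + card U" "card A \<le> 4 * s"
    using positionD(1-5,7,9,10,12)[OF pos] by simp_all
  have vA: "v \<notin> A" using v p(3) by blast
  have cards: "card (insert v A) = Suc (card A)" "Suc (card (U - {v})) = card U"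
    using fin v vA card_Suc_Diff1[OF fin(2) v] by auto
  have deg: "card {e \<in> B. v \<in> e} < D" using breaker_degree_less[OF pos v] .
  have few: "card (insert v A - C) \<le> s \<and> (\<forall>z\<in>insert v A - C. card (E \<inter> between {z} (U - {v})) < D)"
    if more: "4 * s < card A + card U"
  proof
    have "E \<inter> between {v} (U - {v}) \<subseteq> {e \<in> B. v \<in> e}"
    proof
      fix e assume "e \<in> E \<inter> between {v} (U - {v})"
      then obtain y where y: "y \<in> U - {v}" "e = {v, y}" "e \<in> E" by (auto simp: in_between_iff)
      then have "e \<in> M \<union> B" using stuck more by auto
      moreover have "e \<notin> M" using p(6)[of e] y v by auto
      ultimately show "e \<in> {e \<in> B. v \<in> e}" using y by auto
    qed
    then have "card (E \<inter> between {v} (U - {v})) \<le> card {e \<in> B. v \<in> e}"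
      using fin by (intro card_mono) auto
    then have "card (E \<inter> between {v} (U - {v})) < D" using deg by linarith
    moreover have "card (E \<inter> between {z} (U - {v})) < D" if z: "z \<in> A - C" for z
    proof -
      have "card (E \<inter> between {z} (U - {v})) \<le> card (E \<inter> between {z} U)"
        using finite_E between_mono[of "{z}" "{z}" "U - {v}" U] by (intro card_mono) auto
      then show ?thesis using p(8)[OF more z] by linarith
    qed
    ultimately show "\<forall>z\<in>insert v A - C. card (E \<inter> between {z} (U - {v})) < D" by blast
    have "card (A - C) \<noteq> s"
    proof
      assume Z: "card (A - C) = s"
      have "card A = 3 * s" using Z card_C p(1) fin card_Diff_subset[of C A] card_mono[of A C]
        by (auto simp: finite_subset)
      then have "s \<le> card U" using more by linarith
      then obtain U0 where U0: "U0 \<subseteq> U" "card U0 = s" by (meson obtain_subset_with_card_n)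
      then obtain z where z: "z \<in> A - C" "D \<le> card (E \<inter> between {z} U0)"
        using spread[of "A - C" U0] Z p(2,3) by blast
      have "card (E \<inter> between {z} U0) \<le> card (E \<inter> between {z} U)"
        using finite_E between_mono[of "{z}" "{z}" U0 U] U0 by (intro card_mono) auto
      then show False using z(2) p(8)[OF more z(1)] by linarith
    qed
    then have "card (A - C) < s" using p(7)[OF more] by linarith
    moreover have "insert v A - C = insert v (A - C)" using v p(1,3) by auto
    ultimately show "card (insert v A - C) \<le> s" using fin vA by simp
  qed
  have le: "card (insert v A) \<le> 4 * s"
  proof (cases "4 * s = card A + card U")
    case True
    then show ?thesis using cards by linarith
  next
    case False
    then have "card (insert v A - C) \<le> s" using few p(9) by linarith
    moreover have "card (insert v A - C) = card (insert v A) - card C"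
      using p(1) fin by (intro card_Diff_subset) (auto intro: finite_subset)
    ultimately show ?thesis using card_C by linarith
  qed
  have liv: "live M (insert v A) (U - {v}) = live M A U" using v by (auto simp: live_def)
  have "pair_weight B (insert v A) (U - {v}) x \<le> pair_weight B A U x" if "x \<in> live M A U" for x
  proof -
    obtain S T where x: "x = (S, T)" by (cases x)
    show ?thesis
    proof (cases "v \<in> S")
      case True
      have "card (B \<inter> between (S \<inter> insert v A) T) \<le>
          card (B \<inter> between (S \<inter> A) T \<union> {e \<in> B. v \<in> e})"
        using fin by (intro card_mono) (fastforce simp: in_between_iff)+
      also have "\<dots> \<le> card (B \<inter> between (S \<inter> A) T) + card {e \<in> B. v \<in> e}" by (rule card_Un_le)
      finally have 1: "card (B \<inter> between (S \<inter> insert v A) T) < card (B \<inter> between (S \<inter> A) T) + D"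
        using deg by linarith
      have "Suc (card (S \<inter> (U - {v}))) = card (S \<inter> U)"
        using fin v True by (metis Int_Diff IntI card_Suc_Diff1 finite_Int)
      then have 2: "real (card (S \<inter> U)) = 1 + real (card (S \<inter> (U - {v})))" by linarith
      show ?thesis unfolding x pair_weight_def
        using 1 q_gt_1 by (simp add: 2 algebra_simps)
    next
      case False
      then have "S \<inter> (U - {v}) = S \<inter> U" "S \<inter> insert v A = S \<inter> A" by auto
      then show ?thesis by (simp add: x pair_weight_def)
    qed
  qed
  then have "(\<Sum>x\<in>live M A U. pair_weight B (insert v A) (U - {v}) x) \<le>
      (\<Sum>x\<in>live M A U. pair_weight B A U x)" by (rule sum_mono)
  moreover have "(\<Sum>v\<in>U - {v}. vertex_weight B v) \<le> (\<Sum>v\<in>U. vertex_weight B v)"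
    using fin by (intro sum_mono2) (auto intro: less_imp_le[OF vertex_weight_pos])
  ultimately have "potential M B (insert v A) (U - {v}) < 1"
    using positionD(13)[OF pos] unfolding potential_def liv by linarith
  moreover have W_eq: "W - insert v A - (U - {v}) = W - A - U" using v by auto
  moreover have card_eq: "card (insert v A) + card (U - {v}) = card A + card U" using cards by linarith
  moreover have un_eq: "insert v A \<union> (U - {v}) = A \<union> U" using v by auto
  ultimately show ?thesis
    unfolding position_def W_eq card_eq un_eq
  proof (intro conjI)
    show "4 * s < card A + card U \<longrightarrow> card (insert v A - C) \<le> s \<and>
        (\<forall>z\<in>insert v A - C. real (card (E \<inter> between {z} (U - {v}))) < D)"
      using few by (intro impI)
    show "\<exists>P\<subseteq>M. pairwise disjnt P \<and> \<Union> P = W - A - U" "M \<inter> B = {}" "even (card A + card U)"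
      using positionD(8,6,11)[OF pos] .
    show "\<forall>e\<in>M. e \<inter> (U - {v}) = {}" using p(6) by blast
  qed (use p le in auto)
qed

text \<open>
  The balance of a round. An edge from an active vertex to \<open>R\<close> affects no vertex weight, and every
  other edge affects at most two vertex weights and no pair weight. In both cases the affected
  weight is at most \<open>2 g\<close>, if \<open>g\<close> bounds all single weights. So Breaker's move costs at most \<open>g\<close>,
  the amount by which Maker's move has decreased the potential.
\<close>

lemma position_after_round:
  assumes pos: "position M B A U" and f: "f \<in> E - (M \<union> B)" and U': "U' \<subseteq> U"
    and struct: "\<And>e. e \<in> insert f M \<Longrightarrow> e \<inter> U' = {}"
      "\<exists>P\<subseteq>insert f M. pairwise disjnt P \<and> \<Union>P = W - A - U'"
      "4 * s \<le> card A + card U'" "even (card A + card U')"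
    and gain: "potential (insert f M) B A U' + g \<le> potential M B A U"
    and vertex: "\<And>v. v \<in> U \<Longrightarrow> vertex_weight B v \<le> g"
    and edge: "\<And>e. e \<in> (E - (M \<union> B)) \<inter> between A R \<Longrightarrow> edge_weight (insert f M) B A U' e \<le> g"
    and g: "0 \<le> g" and S: "S \<subseteq> E - (B \<union> insert f M)" "card S \<le> b"
  shows "position (insert f M) (B \<union> S) A U'"
proof -
  note fin = position_finite[OF pos]
  have finU': "finite U'" using U' fin(2) finite_subset by blast
  have p: "A \<union> U \<subseteq> W" "A \<inter> U = {}" "B \<subseteq> E"
    "4 * s < card A + card U \<Longrightarrow> card (A - C) \<le> s"
    "\<And>z. 4 * s < card A + card U \<Longrightarrow> z \<in> A - C \<Longrightarrow> card (E \<inter> between {z} U) < D"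
    using positionD(2,3,5,12)[OF pos] by simp_all
  have "potential (insert f M) (B \<union> S) A U' \<le> potential (insert f M) B A U' + g"
  proof (rule potential_breaker_le)
    fix e assume e: "e \<in> S"
    show "(\<Sum>v\<in>e \<inter> U'. vertex_weight B v) + edge_weight (insert f M) B A U' e \<le> 2 * g"
    proof (cases "e \<in> between A R")
      case True
      then have "e \<inter> U' = {}" using p(1,2) U' W_R by (auto simp: in_between_iff)
      moreover have "edge_weight (insert f M) B A U' e \<le> g" using edge True e S(1) by blast
      ultimately show ?thesis using g by simp
    next
      case False
      have "pairs_through (insert f M) A U' e = {}"
      proof (rule ccontr)
        assume "pairs_through (insert f M) A U' e \<noteq> {}"
        then obtain S T where ST: "(S, T) \<in> hall_pairs W R C s" "e \<in> between (S \<inter> A) T"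
          by (auto simp: pairs_through_def live_def)
        then have "e \<in> between A R"
          using hall_pairs_subset[OF ST(1)] between_mono[of "S \<inter> A" A T R] by auto
        with False show False ..
      qed
      then have "edge_weight (insert f M) B A U' e = 0" by (simp add: edge_weight_def)
      moreover have "(\<Sum>v\<in>e \<inter> U'. vertex_weight B v) \<le> (\<Sum>v\<in>e \<inter> U'. g)"
        using vertex U' by (intro sum_mono) auto
      moreover have "card (e \<inter> U') \<le> 2"
      proof -
        have "card e = 2" using e S(1) card_edge by blast
        then show ?thesis by (metis Int_lower1 card.infinite card_mono zero_neq_numeral)
      qed
      then have "real (card (e \<inter> U')) * g \<le> 2 * g" using g by (intro mult_right_mono) auto
      ultimately show ?thesis by simp
    qed
  qed (use S g p finU' in auto)
  then have "potential (insert f M) (B \<union> S) A U' < 1"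
    using gain positionD(13)[OF pos] by linarith
  moreover have few: "card (A - C) \<le> s \<and> (\<forall>z\<in>A - C. card (E \<inter> between {z} U') < D)"
    if "4 * s < card A + card U'"
  proof -
    have more: "4 * s < card A + card U" using that card_mono[OF fin(2) U'] by linarith
    have "card (E \<inter> between {z} U') \<le> card (E \<inter> between {z} U)" for z
      using finite_E between_mono[of "{z}" "{z}" U' U] U' by (intro card_mono) auto
    then show ?thesis using p(4,5)[OF more] by (meson le_less_trans of_nat_le_iff)
  qed
  ultimately show ?thesis
    unfolding position_def
  proof (intro conjI)
    show "4 * s < card A + card U' \<longrightarrow> card (A - C) \<le> s \<and>
        (\<forall>z\<in>A - C. real (card (E \<inter> between {z} U')) < D)"
      using few by (intro impI)
    show "C \<subseteq> A" "card A \<le> 4 * s"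
      using positionD(1,9)[OF pos] .
    show "insert f M \<subseteq> E" "insert f M \<inter> (B \<union> S) = {}"
      using positionD(4,6)[OF pos] f S(1) by auto
    show "\<forall>e\<in>insert f M. e \<inter> U' = {}" using struct(1) by blast
  qed (use struct p U' S in auto)
qed

section \<open>Maker's strategy on a pseudorandom board\<close>

text \<open>
  Once all edges between \<open>A\<close> and \<open>R\<close> are claimed, a pair without an edge of Maker belongs entirely
  to Breaker and thus has weight \<open>1\<close>, which the potential excludes.
\<close>

lemma maker_hits_pair_if_exhausted:
  assumes pos: "position M B A {}" and ex: "E \<inter> between A R \<subseteq> M \<union> B"
    and ST: "(S, T) \<in> hall_pairs W R C s" "S \<subseteq> A"
  shows "M \<inter> between S T \<noteq> {}"
proof
  assume none: "M \<inter> between S T = {}"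
  then have "(S, T) \<in> live M A {}" using ST by (simp add: live_def)
  then have "pair_weight B A {} (S, T) < 1"
    using pair_weight_le_potential positionD(13)[OF pos] by (meson le_less_trans)
  moreover have "E \<inter> between S T = B \<inter> between (S \<inter> A) T"
  proof -
    have SA: "S \<inter> A = S" using ST(2) by blast
    have "between S T \<subseteq> between A R" using ST hall_pairs_subset by (intro between_mono) auto
    then show ?thesis using ex none positionD(5)[OF pos] unfolding SA by blast
  qed
  then have "pair_weight B A {} (S, T) = 1" using q_gt_1 by (simp add: pair_weight_def)
  ultimately show False by simp
qed

text \<open>
  A set that violates Hall's condition in Maker's graph between \<open>A\<close> and \<open>R\<close> yields a pair which
  Maker has not hit. So Maker's graph has a perfect matching there, which completes the matching
  of the first phase.
\<close>

lemma perfect_matching_if_exhausted: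
  assumes pos: "position M B A {}" and A: "card A = 4 * s" and ex: "E \<inter> between A R \<subseteq> M \<union> B"
  shows "\<exists>F\<subseteq>M. card F = card W div 2 + 2 * s \<and> pairwise disjnt F"
proof -
  note fin = position_finite[OF pos]
  note p = positionD[OF pos]
  define N where "N a = {y \<in> R. {a, y} \<in> M}" for a
  have AR: "A \<inter> R = {}" using p(2) W_R by blast
  have AC: "card (A - C) = 2 * s"
    using card_Diff_subset[of C A] p(1) A card_C fin by (simp add: finite_subset)
  have "card J \<le> card (\<Union>(N ` J))" if J: "J \<subseteq> A" for J
  proof (rule ccontr)
    assume less: "\<not> ?thesis"
    have finJ: "finite J" using J fin(1) finite_subset by blast
    have J4: "card J \<le> 4 * s" using J A fin card_mono by metis
    have NR: "\<Union>(N ` J) \<subseteq> R" by (auto simp: N_def)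
    \<comment> \<open>The non-neighbours of \<open>J\<close> are cut down to the exact size that the pairs have.\<close>
    have "card (R - \<Union>(N ` J)) = 4 * s - card (\<Union>(N ` J))"
      using NR finite_R card_R by (simp add: card_Diff_subset finite_subset)
    then have "4 * s + 1 - card J \<le> card (R - \<Union>(N ` J))" using less by linarith
    then obtain T where T: "T \<subseteq> R - \<Union>(N ` J)" "card T = 4 * s + 1 - card J"
      by (meson obtain_subset_with_card_n)
    have no_edge: "{x, y} \<notin> M" if "x \<in> J" "y \<in> T" for x y
      using that T(1) unfolding N_def by blast
    have none: "M \<inter> between S T = {}" if "S \<subseteq> J" for S
    proof -
      have "{x, y} \<notin> M" if "x \<in> S" "y \<in> T" for x y
        using no_edge that \<open>S \<subseteq> J\<close> by blast
      then show ?thesis by (auto simp: in_between_iff)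
    qed
    show False
    proof (cases "card J \<le> 3 * s")
      case True
      have "J \<noteq> {}" using less by auto
      then have "1 \<le> card J" using finJ by (simp add: Suc_le_eq card_gt_0_iff)
      then have "(J, T) \<in> hall_pairs W R C s"
        unfolding hall_pairs_def using True T J p(2) J4 by auto
      then show False using maker_hits_pair_if_exhausted[OF pos ex _ J] none by blast
    next
      case False
      have "card J \<le> card (J \<inter> C) + card (A - C)"
      proof -
        have "card J \<le> card ((J \<inter> C) \<union> (A - C))" using J fin finJ by (intro card_mono) auto
        also have "\<dots> \<le> card (J \<inter> C) + card (A - C)" by (rule card_Un_le)
        finally show ?thesis .
      qed
      then have "2 * s + 1 - card T \<le> card (J \<inter> C)" using AC T(2) J4 by linarith
      then obtain S where S: "S \<subseteq> J \<inter> C" "card S = 2 * s + 1 - card T"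
        by (meson obtain_subset_with_card_n)
      have "(S, T) \<in> hall_pairs W R C s"
        unfolding hall_pairs_def using S T J4 False by auto
      then show False using maker_hits_pair_if_exhausted[OF pos ex] none S(1) J by blast
    qed
  qed
  then obtain f where f: "inj_on f A" "\<And>x. x \<in> A \<Longrightarrow> f x \<in> N x"
    using hall_injection[of A N] fin(1) finite_R by (auto simp: N_def)
  define Q where "Q = (\<lambda>a. {a, f a}) ` A"
  have fR: "f a \<in> R" "{a, f a} \<in> M" if "a \<in> A" for a using f(2)[OF that] by (auto simp: N_def)
  have QM: "Q \<subseteq> M" using fR by (auto simp: Q_def)
  have "inj_on (\<lambda>a. {a, f a}) A"
  proof (rule inj_onI)
    fix a a' assume a: "a \<in> A" "a' \<in> A" "{a, f a} = {a', f a'}"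
    then have "a \<noteq> f a'" using fR AR by blast
    then show "a = a'" using a(3) by auto
  qed
  then have cardQ: "card Q = 4 * s" using A by (simp add: Q_def card_image)
  have disjQ: "pairwise disjnt Q"
  proof (rule pairwiseI)
    fix e e' assume e: "e \<in> Q" "e' \<in> Q" "e \<noteq> e'"
    then obtain a a' where a: "a \<in> A" "a' \<in> A" "e = {a, f a}" "e' = {a', f a'}" by (auto simp: Q_def)
    then have "a \<noteq> a'" using e(3) by auto
    moreover have "f a \<noteq> f a'" using f(1) a \<open>a \<noteq> a'\<close> by (auto dest: inj_onD)
    moreover have "a \<noteq> f a'" "a' \<noteq> f a" using fR a AR by blast+
    ultimately show "disjnt e e'" using a by (auto simp: disjnt_def)
  qed
  obtain P where P: "P \<subseteq> M" "pairwise disjnt P" "\<Union>P = W - A" using p(8) by auto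
  have finP: "finite P" using P(1) fin(3) finite_subset by blast
  have "card (\<Union>P) = (\<Sum>e\<in>P. card e)"
  proof (rule card_Union_disjoint[OF P(2)])
    fix e assume "e \<in> P"
    then have "card e = 2" using P(1) p(4) card_edge by blast
    then show "finite e" by (simp add: card_ge_0_finite)
  qed
  also have "\<dots> = (\<Sum>e\<in>P. 2)" using P(1) p(4) card_edge by (intro sum.cong) auto
  finally have "card (W - A) = 2 * card P" using P(3) by simp
  moreover have "card (W - A) = card W - 4 * s"
    using p(2) A fin by (simp add: card_Diff_subset)
  ultimately have cardP: "2 * card P = card W - 4 * s" by simp
  have PQ: "disjnt e e'" if "e \<in> P" "e' \<in> Q" for e e'
  proof -
    have "e \<subseteq> W - A" using that(1) P(3) by blast
    moreover have "e' \<subseteq> A \<union> R" using that(2) fR by (auto simp: Q_def)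
    ultimately show ?thesis using W_R by (auto simp: disjnt_def)
  qed
  have "P \<inter> Q = {}"
  proof (rule ccontr)
    assume "P \<inter> Q \<noteq> {}"
    then obtain e where "e \<in> P" "e \<in> Q" by blast
    then have "e = {}" using PQ[of e e] by (simp add: disjnt_def)
    then show False using \<open>e \<in> Q\<close> by (auto simp: Q_def)
  qed
  then have "card (P \<union> Q) = card P + card Q"
    using finP fin(1) by (intro card_Un_disjoint) (auto simp: Q_def)
  then have "card (P \<union> Q) = card W div 2 + 2 * s" using cardP cardQ W_size by linarith
  moreover have "pairwise disjnt (P \<union> Q)"
    using P(2) disjQ PQ by (auto simp: pairwise_def disjnt_sym)
  ultimately show ?thesis using P(1) QM by (intro exI[of _ "P \<union> Q"]) auto
qed

text \<open>
  Matching the heaviest vertex \<open>v\<close> removes its weight from the potential. Pairs that contain an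
  endpoint of the new matching edge disappear, and the other weights are unaffected.
\<close>

lemma position_after_matching_edge:
  assumes pos: "position M B A U" and more: "4 * s < card A + card U"
    and v: "v \<in> U" "y \<in> U" "v \<noteq> y" "{v, y} \<in> E - (M \<union> B)"
    and vertex: "\<And>u. u \<in> U \<Longrightarrow> vertex_weight B u \<le> vertex_weight B v"
    and edge: "\<And>e. e \<in> (E - (M \<union> B)) \<inter> between A R \<Longrightarrow> edge_weight M B A U e \<le> vertex_weight B v"
    and S: "S \<subseteq> E - (B \<union> insert {v, y} M)" "card S \<le> b"
  shows "position (insert {v, y} M) (B \<union> S) A (U - {v, y})"
proof -
  note fin = position_finite[OF pos]
  note p = positionD[OF pos]
  let ?U = "U - {v, y}" and ?M = "insert {v, y} M"
  have U_eq: "U = insert v (insert y ?U)" using v by auto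
  have cardU: "card U = card ?U + 2"
    using fin(2) v by (subst U_eq) auto
  have live_sub: "live ?M A ?U \<subseteq> live M A U" by (auto simp: live_def)
  have weight_eq: "pair_weight B A ?U x = pair_weight B A U x" if "x \<in> live ?M A ?U" for x
  proof -
    obtain S T where x: "x = (S, T)" by (cases x)
    then have "S \<subseteq> A \<union> ?U" using that by (simp add: live_def)
    then have "S \<inter> ?U = S \<inter> U" using p(3) v by auto
    then show ?thesis by (simp add: x pair_weight_def)
  qed
  have "(\<Sum>x\<in>live ?M A ?U. pair_weight B A ?U x) \<le> (\<Sum>x\<in>live M A U. pair_weight B A U x)"
    using weight_eq finite_live live_sub
    by (simp add: sum_mono2 less_imp_le[OF pair_weight_pos])
  moreover have "(\<Sum>u\<in>U. vertex_weight B u) =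
      vertex_weight B v + vertex_weight B y + (\<Sum>u\<in>?U. vertex_weight B u)"
    using fin(2) v by (subst U_eq) auto
  ultimately have gain: "potential ?M B A ?U + vertex_weight B v \<le> potential M B A U"
    using vertex_weight_pos[of B y] unfolding potential_def by linarith
  obtain P where P: "P \<subseteq> M" "pairwise disjnt P" "\<Union>P = W - A - U" using p(8) by blast
  show ?thesis
  proof (rule position_after_round[OF pos v(4) _ _ _ _ _ gain vertex _ _ S])
    show "e \<inter> ?U = {}" if "e \<in> ?M" for e using that p(7) by auto
    have "\<Union>(insert {v, y} P) = W - A - ?U" using P(3) v p(2,3) by auto
    moreover have "pairwise disjnt (insert {v, y} P)"
      unfolding pairwise_insert using P(2,3) v by (auto simp: disjnt_def)
    ultimately show "\<exists>P\<subseteq>?M. pairwise disjnt P \<and> \<Union>P = W - A - ?U"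
      using P(1) by (intro exI[of _ "insert {v, y} P"]) auto
    show "4 * s \<le> card A + card ?U" using more cardU p(11) by presburger
    show "even (card A + card ?U)" using p(11) cardU by simp
    fix e assume e: "e \<in> (E - (M \<union> B)) \<inter> between A R"
    have "edge_weight ?M B A ?U e \<le> edge_weight M B A U e"
      unfolding edge_weight_def
      using weight_eq finite_pairs_through live_sub
      by (subst sum.cong[OF refl weight_eq])
        (auto simp: pairs_through_def intro!: sum_mono2 less_imp_le[OF pair_weight_pos]
          finite_subset[OF _ finite_live])
    then show "edge_weight ?M B A ?U e \<le> vertex_weight B v" using edge[OF e] by linarith
  qed (auto intro: less_imp_le[OF vertex_weight_pos])
qed

text \<open>
  Claiming \<open>f\<close> hits exactly those pairs whose weights add up to the weight of \<open>f\<close>, because \<open>f\<close> joins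
  an active vertex to \<open>R\<close>.
\<close>

lemma position_after_board_edge:
  assumes pos: "position M B A U" and f: "f \<in> (E - (M \<union> B)) \<inter> between A R"
    and vertex: "\<And>u. u \<in> U \<Longrightarrow> vertex_weight B u \<le> edge_weight M B A U f"
    and edge: "\<And>e. e \<in> (E - (M \<union> B)) \<inter> between A R \<Longrightarrow>
      edge_weight M B A U e \<le> edge_weight M B A U f"
    and S: "S \<subseteq> E - (B \<union> insert f M)" "card S \<le> b"
  shows "position (insert f M) (B \<union> S) A U"
proof -
  note p = positionD[OF pos]
  let ?M = "insert f M"
  have "f \<in> between S T \<longleftrightarrow> f \<in> between (S \<inter> A) T" if "(S, T) \<in> hall_pairs W R C s" for S T
  proof -
    obtain a x where "a \<in> A" "x \<in> R" "f = {a, x}" using f by (auto simp: in_between_iff)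
    then show ?thesis using hall_pairs_subset[OF that] W_R p(2)
      by (auto simp: in_between_iff doubleton_eq_iff)
  qed
  then have live_eq: "live ?M A U = live M A U - pairs_through M A U f"
    by (auto simp: live_def pairs_through_def)
  have "pairs_through M A U f \<subseteq> live M A U" by (auto simp: pairs_through_def)
  then have "(\<Sum>x\<in>live M A U. pair_weight B A U x) =
      (\<Sum>x\<in>live ?M A U. pair_weight B A U x) + edge_weight M B A U f"
    unfolding live_eq edge_weight_def using finite_live by (rule sum.subset_diff)
  then have gain: "potential ?M B A U + edge_weight M B A U f \<le> potential M B A U"
    unfolding potential_def by linarith
  show ?thesis
  proof (rule position_after_round[OF pos _ _ _ _ _ _ gain vertex _ _ S])
    show "f \<in> E - (M \<union> B)" using f by blast
    show "e \<inter> U = {}" if "e \<in> ?M" for e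
      using that p(2,3,7) f W_R by (auto simp: in_between_iff)
    show "\<exists>P\<subseteq>?M. pairwise disjnt P \<and> \<Union>P = W - A - U" using p(8) by blast
    fix e assume e: "e \<in> (E - (M \<union> B)) \<inter> between A R"
    have "edge_weight ?M B A U e \<le> edge_weight M B A U e"
      unfolding edge_weight_def
      by (intro sum_mono2 less_imp_le[OF pair_weight_pos] finite_pairs_through)
        (auto simp: pairs_through_def live_eq)
    then show "edge_weight ?M B A U e \<le> edge_weight M B A U f" using edge[OF e] by linarith
  next
    show "0 \<le> edge_weight M B A U f"
      unfolding edge_weight_def by (intro sum_nonneg less_imp_le[OF pair_weight_pos])
  qed (use p in auto)
qed

definition matchings :: "'a set set set" where
  "matchings = {F. F \<subseteq> E \<and> card F = card W div 2 + 2 * s \<and> pairwise disjnt F}"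

text \<open>
  The matching edges still to be claimed in the first phase, plus the edges to \<open>R\<close> that Maker may
  still claim; he never gets more than \<open>L\<close> of the latter because at most \<open>L\<close> edges run
  between the active vertices and \<open>R\<close>. Activations do not change this number.
\<close>

definition moves_left :: "'a set set \<Rightarrow> 'a set \<Rightarrow> 'a set \<Rightarrow> nat" where
  "moves_left M A U = (card A + card U - 4 * s) div 2 + (L - card (M \<inter> between A R))"

text \<open>
  The choice of Maker's move. First all stuck vertices are activated (and all of \<open>U\<close>, if \<open>A \<union> U\<close>
  has just \<open>4s\<close> elements), by induction on the size of \<open>U\<close>. Then Maker removes the largest weight
  among the vertices of \<open>U\<close> and the free edges between \<open>A\<close> and \<open>R\<close>. If there is nothing to choose
  from, the second phase is over and he has won.
\<close>

lemma position_progress: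
  assumes "position M B A U"
  shows "(\<exists>F\<in>matchings. F \<subseteq> M) \<or>
    (\<exists>f\<in>E - (M \<union> B). \<forall>S. S \<subseteq> E - (B \<union> insert f M) \<longrightarrow> card S \<le> b \<longrightarrow>
       (\<exists>A' U'. position (insert f M) (B \<union> S) A' U' \<and> moves_left (insert f M) A' U' < moves_left M A U))"
  using assms
proof (induction "card U" arbitrary: A U rule: less_induct)
  case less
  note pos = less.prems
  note fin = position_finite[OF pos]
  note p = positionD[OF pos]
  let ?free = "E - (M \<union> B)"
  show ?case
  proof (cases "\<exists>v\<in>U. 4 * s = card A + card U \<or> (\<forall>y\<in>U - {v}. {v, y} \<notin> ?free)")
    case True
    then obtain v where v: "v \<in> U" "4 * s = card A + card U \<or> (\<forall>y\<in>U - {v}. {v, y} \<notin> ?free)" by blast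
    have "card (insert v A) + card (U - {v}) = card A + card U"
    proof -
      have "v \<notin> A" using v(1) p(3) by blast
      then show ?thesis
        using card_Suc_Diff1[OF fin(2) v(1)] card_insert_disjoint[OF fin(1)] by simp
    qed
    moreover have "M \<inter> between (insert v A) R = M \<inter> between A R"
    proof -
      have "{v, y} \<notin> M" for y using bspec[OF p(7), of "{v, y}"] v(1) by auto
      then show ?thesis by (auto simp: in_between_iff)
    qed
    ultimately have "moves_left M (insert v A) (U - {v}) = moves_left M A U"
      by (simp add: moves_left_def)
    then show ?thesis
      using less.hyps[of "U - {v}" "insert v A"] position_activate[OF pos v]
        card_Diff1_less[OF fin(2) v(1)] by simp
  next
    case unstuck: False
    let ?board = "?free \<inter> between A R"
    let ?weights = "vertex_weight B ` U \<union> edge_weight M B A U ` ?board"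
    have fin_weights: "finite ?weights"
      by (intro finite_UnI finite_imageI finite_Int disjI1 finite_Diff fin(2) finite_E)
    show ?thesis
    proof (cases "?weights = {}")
      case True
      then have "U = {}" and ex: "E \<inter> between A R \<subseteq> M \<union> B" by blast+
      then have "card A = 4 * s" "position M B A {}" using p(9,10) pos by simp_all
      then obtain F where "F \<subseteq> M" "card F = card W div 2 + 2 * s" "pairwise disjnt F"
        using perfect_matching_if_exhausted ex by blast
      then have "F \<in> matchings" using p(4) by (simp add: matchings_def)
      then show ?thesis using \<open>F \<subseteq> M\<close> by blast
    next
      case False
      define g where "g = Max ?weights"
      have g_max: "\<And>u. u \<in> U \<Longrightarrow> vertex_weight B u \<le> g" "\<And>e. e \<in> ?board \<Longrightarrow> edge_weight M B A U e \<le> g"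
        using fin_weights by (auto simp: g_def intro!: Max_ge)
      have "g \<in> ?weights" unfolding g_def using fin_weights False by (rule Max_in)
      then consider v where "v \<in> U" "g = vertex_weight B v"
        | f where "f \<in> ?board" "g = edge_weight M B A U f" by blast
      then show ?thesis
      proof cases
        case (1 v)
        then obtain y where y: "y \<in> U" "v \<noteq> y" "{v, y} \<in> ?free" using unstuck by auto
        have more: "4 * s < card A + card U" using unstuck 1(1) p(10) by auto
        have "card {v, y} = 2" using y(2) by simp
        moreover have "card {v, y} \<le> card U" using 1(1) y(1) fin(2) by (intro card_mono) auto
        ultimately have card2: "card (U - {v, y}) + 2 = card U"
          using 1(1) y(1) fin(2) by (subst card_Diff_subset) auto
        have "insert {v, y} M \<inter> between A R = M \<inter> between A R"
          using 1(1) p(3) by (auto simp: in_between_iff doubleton_eq_iff) (use y p in blast)+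
        then have "moves_left (insert {v, y} M) A (U - {v, y}) < moves_left M A U"
          using card2 more p(11) unfolding moves_left_def by presburger
        moreover have "position (insert {v, y} M) (B \<union> S) A (U - {v, y})"
          if "S \<subseteq> E - (B \<union> insert {v, y} M)" "card S \<le> b" for S
          using position_after_matching_edge[OF pos more 1(1) y] g_max 1(2) that by simp
        ultimately show ?thesis using y(3) by blast
      next
        case (2 f)
        have "insert f M \<inter> between A R = insert f (M \<inter> between A R)" using 2(1) by blast
        then have "card (insert f M \<inter> between A R) = Suc (card (M \<inter> between A R))"
          using 2(1) fin(3) by simp
        moreover have "card (insert f M \<inter> between A R) \<le> card (E \<inter> between A R)"
          using 2(1) finite_E p(4) by (intro card_mono) auto
        moreover have "card (E \<inter> between A R) \<le> L" using few_edges p(2,9) by simp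
        ultimately have "moves_left (insert f M) A U < moves_left M A U"
          unfolding moves_left_def by linarith
        moreover have "position (insert f M) (B \<union> S) A U"
          if "S \<subseteq> E - (B \<union> insert f M)" "card S \<le> b" for S
          using position_after_board_edge[OF pos 2(1)] g_max 2(2) that by simp
        ultimately show ?thesis using 2(1) by blast
      qed
    qed
  qed
qed

lemma forces_win_if_position:
  assumes "position M B A U" "moves_left M A U \<le> k"
  shows "forces_win b E matchings k M B"
  using assms
proof (induction k arbitrary: M B A U)
  case 0
  then show ?case using position_progress[OF 0(1)] by auto
next
  case (Suc k)
  show ?case
  proof (cases "\<exists>F\<in>matchings. F \<subseteq> M")
    case False
    then obtain f where f: "f \<in> E - (M \<union> B)" and
      reply: "\<And>S. S \<subseteq> E - (B \<union> insert f M) \<Longrightarrow> card S \<le> b \<Longrightarrow>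
       \<exists>A' U'. position (insert f M) (B \<union> S) A' U' \<and> moves_left (insert f M) A' U' < moves_left M A U"
      using position_progress[OF Suc.prems(1)] by auto
    have "0 < card (E - (B \<union> M))"
      using f finite_E by (auto simp: card_gt_0_iff)
    then have "legal_move 1 (E - (B \<union> M)) {f}"
      using f by (auto simp: legal_move_def)
    moreover have "forces_win b E matchings k (M \<union> {f}) (B \<union> S)"
      if S: "legal_move b (E - (B \<union> (M \<union> {f}))) S" for S
    proof -
      have "S \<subseteq> E - (B \<union> insert f M)" "card S \<le> b" using S by (auto simp: legal_move_def)
      then obtain A' U' where "position (insert f M) (B \<union> S) A' U'"
          "moves_left (insert f M) A' U' < moves_left M A U" using reply by blast
      then show ?thesis using Suc.IH[of "insert f M" "B \<union> S" A' U'] Suc.prems(2) by simp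
    qed
    ultimately show ?thesis unfolding forces_win.simps(2) by blast
  qed simp
qed

lemma maker_wins:
  "maker_wins_within 1 b E matchings (real (card W) / 2 + real L)"
proof (rule maker_wins_within_if_forces_win[where k = "(card W - 4 * s) div 2 + L"])
  let ?U = "W - C"
  have finC: "finite C" by (rule finite_subset[OF C_W finite_W])
  have card_CW: "card C \<le> card W" by (rule card_mono[OF finite_W C_W])
  have cards: "card C + card ?U = card W"
    using finC C_W card_CW by (simp add: card_Diff_subset)
  fix S assume S: "legal_move b E S"
  have SE: "S \<subseteq> E" "card S \<le> b" using S by (auto simp: legal_move_def)
  have finS: "finite S" using SE finite_E finite_subset by blast
  have small: "q powr real j \<le> 2" if "j \<le> card S" for j
    using order_trans[OF power_increasing[of j b q] q_pow] q_gt_1 SE(2) that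
    by (simp add: powr_realpow)
  have "vertex_weight S v \<le> 2 * q powr (- D)" for v
  proof -
    have "vertex_weight S v = q powr real (card {e \<in> S. v \<in> e}) * q powr (- D)"
      by (simp add: vertex_weight_def powr_add[symmetric])
    also have "\<dots> \<le> 2 * q powr (- D)"
      using finS by (intro mult_right_mono small card_mono) auto
    finally show ?thesis .
  qed
  then have "(\<Sum>v\<in>?U. vertex_weight S v) \<le> (\<Sum>v\<in>?U. 2 * q powr (- D))" by (intro sum_mono)
  also have "\<dots> \<le> 2 * (real (card W) * q powr (- D))"
    using cards by (simp add: mult_right_mono)
  finally have 1: "(\<Sum>v\<in>?U. vertex_weight S v) \<le> 2 * (real (card W) * q powr (- D))" .
  let ?w = "\<lambda>(S, T). q powr (D * card (S - C) - card (E \<inter> between S T))"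
  have "pair_weight S C ?U x \<le> 2 * ?w x" if x: "x \<in> hall_pairs W R C s" for x
  proof -
    obtain S' T where x': "x = (S', T)" by (cases x)
    have "S' \<inter> ?U = S' - C" using hall_pairs_subset[of S' T] x x' by auto
    then have "pair_weight S C ?U x = q powr real (card (S \<inter> between (S' \<inter> C) T)) * ?w x"
      by (simp add: pair_weight_def x' powr_add[symmetric] add_ac)
    also have "\<dots> \<le> 2 * ?w x"
      using finS by (intro mult_right_mono small card_mono) (auto simp: x')
    finally show ?thesis .
  qed
  then have "(\<Sum>x\<in>live {} C ?U. pair_weight S C ?U x) \<le> (\<Sum>x\<in>hall_pairs W R C s. 2 * ?w x)"
    using finite_hall_pairs
    by (intro order_trans[OF sum_mono sum_mono2]) (auto simp: live_def)
  also have "\<dots> = 2 * (\<Sum>x\<in>hall_pairs W R C s. ?w x)" by (simp add: sum_distrib_left)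
  finally have "potential {} S C ?U < 1" using 1 start unfolding potential_def by linarith
  then have "position {} S C ?U"
    unfolding position_def using C_W SE card_C cards W_size by auto
  moreover have "moves_left {} C ?U = (card W - 4 * s) div 2 + L"
    using cards by (simp add: moves_left_def)
  ultimately show "forces_win b E matchings ((card W - 4 * s) div 2 + L) {} S"
    by (intro forces_win_if_position) auto
qed (use W_size in \<open>auto simp: field_simps\<close>)

end

section \<open>Exponential moments in the random graph\<close>

lemma finite_all_edges: "finite (all_edges n)"
  by (rule finite_subset[of _ "Pow {..<n}"]) (auto simp: all_edges_def)

lemma set_random_graph: "E \<in> set_pmf (random_graph n p) \<Longrightarrow> E \<subseteq> all_edges n"
  by (auto simp: random_graph_def)

lemma finite_set_random_graph: "finite (set_pmf (random_graph n p))"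
  by (rule finite_subset[of _ "Pow (all_edges n)"]) (auto dest: set_random_graph simp: finite_all_edges)

text \<open>
  Edges are independent, so that the moment generating function of an edge count factorises. This
  is all the probability theory that is needed: taking \<open>x = 1/q\<close> bounds edge counts from below and
  \<open>x = 2\<close> from above.
\<close>

lemma expectation_power_card_random_graph:
  assumes p: "0 \<le> p" "p \<le> 1" and x: "0 \<le> x" and F: "F \<subseteq> all_edges n"
  shows "measure_pmf.expectation (random_graph n p) (\<lambda>E. x ^ card (E \<inter> F)) =
    (1 - p + p * x) ^ card F"
proof -
  note fin = finite_all_edges[of n]
  have "measure_pmf.expectation (random_graph n p) (\<lambda>E. x ^ card (E \<inter> F)) =
      measure_pmf.expectation (Pi_pmf (all_edges n) False (\<lambda>_. bernoulli_pmf p))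
        (\<lambda>f. \<Prod>e\<in>all_edges n. if e \<in> F \<and> f e then x else 1)"
  proof -
    have "x ^ card ({e \<in> all_edges n. f e} \<inter> F) = (\<Prod>e\<in>all_edges n. if e \<in> F \<and> f e then x else 1)" for f
    proof -
      have "all_edges n \<inter> {e. e \<in> F \<and> f e} = {e \<in> all_edges n. f e} \<inter> F" by auto
      then show ?thesis using fin by (simp add: prod.If_cases)
    qed
    then show ?thesis by (simp add: random_graph_def)
  qed
  also have "\<dots> = (\<Prod>e\<in>all_edges n.
      measure_pmf.expectation (bernoulli_pmf p) (\<lambda>v. if e \<in> F \<and> v then x else 1))"
    using fin x by (intro expectation_prod_Pi_pmf) (auto intro: integrable_measure_pmf_finite)
  also have "\<dots> = (\<Prod>e\<in>all_edges n. if e \<in> F then 1 - p + p * x else 1)"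
    using p by (intro prod.cong) auto
  also have "\<dots> = (1 - p + p * x) ^ card F"
    using fin F by (simp add: prod.If_cases Int_absorb1)
  finally show ?thesis .
qed

lemma prob_random_graph_sum_ge:
  assumes p: "0 \<le> p" "p \<le> 1" and x: "0 \<le> x" and a: "0 < a"
    and fam: "\<And>i. i \<in> I \<Longrightarrow> F i \<subseteq> all_edges n" "\<And>i. i \<in> I \<Longrightarrow> 0 \<le> c i"
  shows "measure_pmf.prob (random_graph n p) {E. a \<le> (\<Sum>i\<in>I. c i * x ^ card (E \<inter> F i))}
    \<le> (\<Sum>i\<in>I. c i * (1 - p + p * x) ^ card (F i)) / a"
proof -
  let ?M = "random_graph n p"
  have int: "integrable (measure_pmf ?M) f" for f :: "nat set set \<Rightarrow> real"
    by (rule integrable_measure_pmf_finite[OF finite_set_random_graph])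
  have "measure_pmf.prob ?M {E \<in> space ?M. a \<le> (\<Sum>i\<in>I. c i * x ^ card (E \<inter> F i))} \<le>
      measure_pmf.expectation ?M (\<lambda>E. \<Sum>i\<in>I. c i * x ^ card (E \<inter> F i)) / a"
    using fam x a by (intro integral_Markov_inequality_measure[where A = "{}"] int)
      (auto intro!: AE_pmfI sum_nonneg)
  also have "measure_pmf.expectation ?M (\<lambda>E. \<Sum>i\<in>I. c i * x ^ card (E \<inter> F i)) =
      (\<Sum>i\<in>I. c i * measure_pmf.expectation ?M (\<lambda>E. x ^ card (E \<inter> F i)))"
    by (simp add: int)
  also have "\<dots> = (\<Sum>i\<in>I. c i * (1 - p + p * x) ^ card (F i))"
    using fam by (intro sum.cong refl) (simp add: expectation_power_card_random_graph[OF p x])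
  finally show ?thesis by simp
qed

text \<open>
  The union bound over pairs: a set \<open>T\<close> with \<open>|T| = |A'| + 1 - |S|\<close> misses only \<open>|S| - 1\<close> elements
  of \<open>A'\<close>, so there are at most \<open>n\<^bsup>2j\<^esup>\<close> pairs with \<open>|S| = j\<close>.
\<close>

lemma sum_complementary_pairs_le:
  fixes y :: real
  assumes fin: "finite A" "finite A'" and n: "card A \<le> n" "card A' \<le> n" "1 \<le> n"
    and y: "0 \<le> y" "real n ^ 2 * y \<le> 1"
  shows "(\<Sum>(S, T) | S \<subseteq> A \<and> T \<subseteq> A' \<and> 1 \<le> card S \<and> card S \<le> k \<and> card S + card T = card A' + 1.
    y ^ card S) \<le> real k * (real n ^ 2 * y)"
proof -
  let ?I = "{(S, T). S \<subseteq> A \<and> T \<subseteq> A' \<and> 1 \<le> card S \<and> card S \<le> k \<and> card S + card T = card A' + 1}"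
  have finI: "finite ?I"
    by (rule finite_subset[of _ "Pow A \<times> Pow A'"]) (auto simp: fin)
  have "(\<Sum>(S, T)\<in>?I. y ^ card S) =
      (\<Sum>j\<in>{1..k}. \<Sum>x | x \<in> ?I \<and> card (fst x) = j. case x of (S, T) \<Rightarrow> y ^ card S)"
    by (rule sum.group[OF finI, symmetric]) auto
  also have "\<dots> \<le> (\<Sum>j\<in>{1..k}. real n ^ 2 * y)"
  proof (rule sum_mono)
    fix j assume j: "j \<in> {1..k}"
    let ?J = "{x \<in> ?I. card (fst x) = j}"
    have pow_le: "m choose i \<le> n ^ j" if "m \<le> n" "i \<le> j" for m i
    proof (cases "i \<le> m")
      case True
      then have "m choose i \<le> m ^ i" by (rule binomial_le_pow)
      also have "\<dots> \<le> n ^ i" using that by (intro power_mono) auto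
      also have "\<dots> \<le> n ^ j" using that n by (intro power_increasing) auto
      finally show ?thesis .
    qed (simp add: binomial_eq_0)
    have "card ?J \<le> n ^ j * n ^ j"
    proof (cases "j \<le> card A' + 1")
      case True
      have "?J \<subseteq> {S. S \<subseteq> A \<and> card S = j} \<times> {T. T \<subseteq> A' \<and> card T = card A' + 1 - j}" by auto
      then have "card ?J \<le> card ({S. S \<subseteq> A \<and> card S = j} \<times> {T. T \<subseteq> A' \<and> card T = card A' + 1 - j})"
        using fin by (intro card_mono) auto
      also have "\<dots> = (card A choose j) * (card A' choose (card A' + 1 - j))"
        using fin by (simp add: card_cartesian_product n_subsets)
      also have "card A' choose (card A' + 1 - j) = card A' choose (j - 1)"
        using j True by (subst binomial_symmetric) auto
      also have "(card A choose j) * \<dots> \<le> n ^ j * n ^ j"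
        using n by (intro mult_mono pow_le) auto
      finally show ?thesis .
    next
      case False
      then have "?J = {}" by auto
      then show ?thesis by (metis card.empty le0)
    qed
    then have "real (card ?J) * y ^ j \<le> real (n ^ j * n ^ j) * y ^ j"
      using y by (intro mult_right_mono) (auto simp del: of_nat_mult of_nat_power)
    also have "\<dots> = (real n ^ 2 * y) ^ j"
      by (simp add: power_mult_distrib power2_eq_square)
    also have "\<dots> \<le> (real n ^ 2 * y) ^ 1"
      using y j by (intro power_decreasing) auto
    finally show "(\<Sum>x | x \<in> ?I \<and> card (fst x) = j. case x of (S, T) \<Rightarrow> y ^ card S) \<le> real n ^ 2 * y"
      by (simp add: case_prod_unfold)
  qed
  finally show ?thesis by simp
qed

lemma between_subset_all_edges:
  assumes "S \<inter> T = {}" "S \<subseteq> {..<n}" "T \<subseteq> {..<n}"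
  shows "between S T \<subseteq> all_edges n"
  using assms by (auto simp: in_between_iff all_edges_def card_insert_if disjoint_iff)

text \<open>
  The value \<open>1 + 1/(4b)\<close> of \<open>q\<close> works since \<open>(1 + 1/(4b))\<^sup>b \<le> e\<^bsup>1/4\<^esup> \<le> 2\<close>.
\<close>

lemma bias_base_bounds:
  assumes "1 \<le> b"
  defines "q \<equiv> 1 + 1 / (4 * real b)"
  shows "1 < q" "q ^ b \<le> 2" "real b * (q - 1) * q ^ b \<le> 1 / 2"
proof -
  show "1 < q" using assms by simp
  have "q \<le> exp (1 / (4 * real b))" unfolding q_def by (rule exp_ge_add_one_self)
  then have "q ^ b \<le> exp (1 / (4 * real b)) ^ b" using \<open>1 < q\<close> by (intro power_mono) auto
  also have "\<dots> = exp (1 / 4)" using assms(1) by (simp add: exp_of_nat_mult[symmetric])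
  also have "\<dots> \<le> 1 + 1 / 4 + (1 / 4)\<^sup>2" by (rule exp_bound) auto
  finally show 2: "q ^ b \<le> 2" by (simp add: power2_eq_square)
  have "real b * (q - 1) = 1 / 4" using assms(1) by (simp add: q_def)
  then have "real b * (q - 1) * q ^ b = 1 / 4 * q ^ b" by (simp only:)
  then show "real b * (q - 1) * q ^ b \<le> 1 / 2" using 2 by linarith
qed

lemma power_one_minus_le_exp:
  fixes t :: real
  assumes "0 \<le> t" "t \<le> 1"
  shows "(1 - t) ^ k \<le> exp (- t * real k)"
proof -
  have "(1 - t) ^ k \<le> exp (- t) ^ k"
    using assms exp_ge_add_one_self[of "- t"] by (intro power_mono) auto
  then show ?thesis by (simp add: exp_of_nat_mult[symmetric] mult.commute)
qed

text \<open>
  The three error terms bound the probabilities that the initial potential is too large, that some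
  two disjoint sets of \<open>s\<close> vertices span too few edges, and that some vertex has more than \<open>\<Delta>\<close>
  neighbours in the reserve. In the first two cases every potential edge between \<open>S\<close> and \<open>T\<close>
  contributes a factor \<open>1 - c p\<close> to the expected weight of the pair \<open>(S, T)\<close>. With \<open>j = |S|\<close> for
  the pairs of the first kind and \<open>j = |T|\<close> for those of the second kind, there are at least
  \<open>s j\<close> potential edges, so the expected weight is at most \<open>(8 n e\<^bsup>-cps\<^esup>)\<^sup>j\<close>, where the factor
  \<open>8 n = q\<^sup>D\<close> accounts for the \<open>D\<close> edges that Breaker may take at every inactive vertex. The
  \<open>n\<^bsup>2j\<^esup>\<close> choices of such a pair turn this into \<open>\<rho>\<^sup>j\<close>.
\<close>

lemma prob_maker_wins_ge:
  fixes n s b :: nat and p \<Delta> :: real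
  defines "c \<equiv> 1 / (4 * real b + 1)"
  defines "\<rho> \<equiv> 8 * real n ^ 3 * exp (- c * p * real s)"
  assumes b: "1 \<le> b" and p: "0 \<le> p" "p \<le> 1" and s: "1 \<le> s" "8 * s < n"
    and \<Delta>: "0 \<le> \<Delta>" and \<rho>: "\<rho> \<le> 1"
  shows "1 - (6 * real n * \<rho> + \<rho> + real n * 2 powr (- \<Delta>) * exp (4 * p * real s)) \<le>
    measure_pmf.prob (random_graph n p)
      {E. maker_wins_within 1 b E (perfect_matching_sets n E) (real n / 2 + 4 * real s * \<Delta>)}"
proof -
  define q where "q = 1 + 1 / (4 * real b)"
  define D where "D = log q (8 * real n)"
  \<comment> \<open>For odd \<open>n\<close> the last vertex stays unmatched, and Maker ignores its edges.\<close>
  define N where "N = 2 * (n div 2)"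
  define R where "R = {..<4 * s}"
  define W where "W = {4 * s..<N}"
  define C where "C = {4 * s..<6 * s}"
  define y where "y = 8 * real n * exp (- c * p * real s)"
  let ?M = "random_graph n p"
  let ?t = "c * p"
  note q = bias_base_bounds[OF b, folded q_def]
  have n: "1 \<le> n" "8 * s \<le> N" "N \<le> n" using s by (auto simp: N_def)
  have cq: "1 - 1 / q = c" using b by (simp add: q_def c_def field_simps)
  have c: "0 < c" "c \<le> 1" using b by (auto simp: c_def)
  have t: "0 \<le> ?t" "?t \<le> 1" using c p by (auto simp: mult_le_one)
  have shrink: "1 - p + p * (1 / q) = 1 - ?t" 
  proof -
    have "1 / q = 1 - c" using cq by simp
    then show ?thesis by (simp only:) (simp add: algebra_simps)
  qed
  have y: "0 \<le> y" by (simp add: y_def)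
  have \<rho>_y: "\<rho> = real n ^ 2 * y" by (simp add: \<rho>_def y_def power3_eq_cube power2_eq_square)
  have qD: "q powr D = 8 * real n" using q(1) n(1) by (simp add: D_def)
  have qDk: "q powr (D * real k) = (8 * real n) ^ k" for k
    using q(1) qD n(1) by (simp add: powr_powr[symmetric] powr_realpow)
  have fin: "finite R" "finite W" "finite C" by (auto simp: R_def W_def C_def)
  have cards: "card R = 4 * s" "card C = 2 * s" "card W = N - 4 * s"
    by (auto simp: R_def W_def C_def)
  have sub: "R \<subseteq> {..<n}" "W \<subseteq> {..<n}" "C \<subseteq> W" "W \<inter> R = {}"
    using n by (auto simp: R_def W_def C_def)
  have hp: "S \<subseteq> W" "T \<subseteq> R" if "(S, T) \<in> hall_pairs W R C s" for S T
    using that sub(3) by (auto simp: hall_pairs_def)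
  have fin_hp: "finite (hall_pairs W R C s)"
  proof (rule finite_subset)
    show "hall_pairs W R C s \<subseteq> Pow W \<times> Pow R"
      by (rule subrelI) (simp add: hp)
  qed (simp add: fin)

  \<comment> \<open>The vertex weights contribute at most \<open>1/8\<close> to the initial potential, which leaves \<open>3/8\<close> for
    the pairs.\<close>
  define bad1 where "bad1 = {E. 3 / 8 \<le> (\<Sum>x\<in>hall_pairs W R C s.
    q powr (D * real (card (fst x - C))) * (1 / q) ^ card (E \<inter> between (fst x) (snd x)))}"
  define pairs where "pairs = {(Z, U). Z \<subseteq> W \<and> U \<subseteq> W \<and> Z \<inter> U = {} \<and> card Z = s \<and> card U = s}"
  define bad2 where "bad2 = {E. 1 \<le> (\<Sum>x\<in>pairs.
    q powr (D * real s) * (1 / q) ^ card (E \<inter> between (fst x) (snd x)))}"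
  define bad3 where "bad3 = {E. 1 \<le> (\<Sum>v\<in>W. 2 powr (- \<Delta>) * 2 ^ card (E \<inter> between {v} R))}"

  have bad1: "measure_pmf.prob ?M bad1 \<le> 6 * real n * \<rho>"
  proof -
    let ?f = "\<lambda>x. q powr (D * real (card (fst x - C))) * (1 - ?t) ^ card (between (fst x) (snd x))"
    have "measure_pmf.prob ?M bad1 \<le> (\<Sum>x\<in>hall_pairs W R C s. ?f x) / (3 / 8)"
      unfolding bad1_def shrink[symmetric]
    proof (rule prob_random_graph_sum_ge[OF p])
      fix x assume "x \<in> hall_pairs W R C s"
      then have "fst x \<subseteq> W" "snd x \<subseteq> R" using hp[of "fst x" "snd x"] by auto
      then show "between (fst x) (snd x) \<subseteq> all_edges n"
        using sub by (intro between_subset_all_edges) auto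
    qed (use q in auto)
    also have "(\<Sum>x\<in>hall_pairs W R C s. ?f x) \<le> real (3 * s) * \<rho> + real s * \<rho>"
    proof -
      let ?I = "{(S, T). S \<subseteq> W \<and> T \<subseteq> R \<and> 1 \<le> card S \<and> card S \<le> 3 * s \<and> card S + card T = 4 * s + 1}"
      let ?II = "{(S, T). S \<subseteq> C \<and> T \<subseteq> R \<and> 1 \<le> card T \<and> card T \<le> s \<and> card S + card T = 2 * s + 1}"
      let ?II' = "{(T, S). T \<subseteq> R \<and> S \<subseteq> C \<and> 1 \<le> card T \<and> card T \<le> s \<and> card T + card S = 2 * s + 1}"
      have decay: "(1 - ?t) ^ card (between S T) \<le> exp (- c * p * real s) ^ j"
        if "S \<inter> T = {}" "s * j \<le> card S * card T" for S T :: "nat set" and j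
      proof -
        have "(1 - ?t) ^ card (between S T) \<le> (1 - ?t) ^ (s * j)"
          using t that by (intro power_decreasing) (auto simp: card_between)
        also have "\<dots> \<le> exp (- ?t * real (s * j))" by (rule power_one_minus_le_exp[OF t])
        also have "\<dots> = exp (- c * p * real s) ^ j"
          by (simp add: exp_of_nat_mult[symmetric] mult_ac)
        finally show ?thesis .
      qed
      have "?f x \<le> y ^ card (fst x)" if x: "x \<in> ?I" for x
      proof -
        have ST: "fst x \<subseteq> W" "snd x \<subseteq> R" "card (fst x) \<le> 3 * s"
            "card (fst x) + card (snd x) = 4 * s + 1" using x by auto
        have "fst x \<inter> snd x = {}" using ST sub(4) by blast
        moreover have "s * card (fst x) \<le> card (fst x) * card (snd x)"
          using ST(3,4) by (simp add: mult.commute)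
        ultimately have "(1 - ?t) ^ card (between (fst x) (snd x)) \<le>
            exp (- c * p * real s) ^ card (fst x)" by (rule decay)
        moreover have "q powr (D * real (card (fst x - C))) \<le> (8 * real n) ^ card (fst x)"
        proof -
          have "finite (fst x)" using ST(1) fin(2) by (rule finite_subset)
          then have "card (fst x - C) \<le> card (fst x)" by (intro card_mono) auto
          then show ?thesis unfolding qDk using n(1) by (intro power_increasing) auto
        qed
        ultimately have "?f x \<le> (8 * real n) ^ card (fst x) * exp (- c * p * real s) ^ card (fst x)"
          using t by (intro mult_mono) auto
        then show ?thesis by (simp add: y_def power_mult_distrib)
      qed
      then have "sum ?f ?I \<le> (\<Sum>(S, T)\<in>?I. y ^ card S)"
        by (intro sum_mono) (auto simp: case_prod_unfold)
      also have "\<dots> \<le> real (3 * s) * \<rho>"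
        using sum_complementary_pairs_le[of W R n y "3 * s"] fin cards n y \<rho> s
        unfolding \<rho>_y by simp
      finally have 1: "sum ?f ?I \<le> real (3 * s) * \<rho>" .
      have "?f x \<le> y ^ card (snd x)" if x: "x \<in> ?II" for x
      proof -
        have ST: "fst x \<subseteq> C" "snd x \<subseteq> R" "card (snd x) \<le> s"
            "card (fst x) + card (snd x) = 2 * s + 1" using x by auto
        have "fst x \<inter> snd x = {}" using ST sub(3,4) by blast
        moreover have "s * card (snd x) \<le> card (fst x) * card (snd x)"
          using ST(3,4) by simp
        ultimately have "(1 - ?t) ^ card (between (fst x) (snd x)) \<le>
            exp (- c * p * real s) ^ card (snd x)" by (rule decay)
        also have "\<dots> \<le> y ^ card (snd x)"
          unfolding y_def using n(1) by (intro power_mono) auto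
        finally have "(1 - ?t) ^ card (between (fst x) (snd x)) \<le> y ^ card (snd x)" .
        moreover have no_weight: "fst x - C = {}" using ST(1) by blast
        ultimately show ?thesis unfolding no_weight using q(1) by simp
      qed
      then have "sum ?f ?II \<le> (\<Sum>(S, T)\<in>?II. y ^ card T)"
        by (intro sum_mono) (auto simp: case_prod_unfold)
      also have "\<dots> = (\<Sum>(T, S)\<in>?II'. y ^ card T)"
        by (rule sum.reindex_bij_witness[of _ prod.swap prod.swap]) auto
      also have "\<dots> \<le> real s * \<rho>"
        using sum_complementary_pairs_le[of R C n y s] fin cards n y \<rho> s
        unfolding \<rho>_y by simp
      finally have 2: "sum ?f ?II \<le> real s * \<rho>" .
      have "finite ?I" "finite ?II"
        using fin_hp by (auto simp: hall_pairs_def)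
      then have "sum ?f (hall_pairs W R C s) \<le> sum ?f ?I + sum ?f ?II"
        unfolding hall_pairs_def using q t by (subst sum.union_inter[symmetric]) (auto intro!: sum_nonneg)
      then show ?thesis using 1 2 by linarith
    qed
    also have "(real (3 * s) * \<rho> + real s * \<rho>) / (3 / 8) = 32 / 3 * real s * \<rho>" by simp
    also have "\<dots> \<le> 6 * real n * \<rho>"
    proof (rule mult_right_mono)
      show "0 \<le> \<rho>" by (simp add: \<rho>_def)
    qed (use s in linarith)
    finally show ?thesis by (simp add: divide_right_mono)
  qed

  have bad2: "measure_pmf.prob ?M bad2 \<le> \<rho>"
  proof -
    have "measure_pmf.prob ?M bad2 \<le>
        (\<Sum>x\<in>pairs. q powr (D * real s) * (1 - ?t) ^ card (between (fst x) (snd x))) / 1"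
      unfolding bad2_def shrink[symmetric]
    proof (rule prob_random_graph_sum_ge[OF p])
      fix x assume "x \<in> pairs"
      then have "fst x \<subseteq> W" "snd x \<subseteq> W" "fst x \<inter> snd x = {}" by (auto simp: pairs_def)
      then show "between (fst x) (snd x) \<subseteq> all_edges n"
        using sub by (intro between_subset_all_edges) auto
    qed (use q in auto)
    also have "\<dots> \<le> (\<Sum>x\<in>pairs. (8 * real n) ^ s * exp (- c * p * real s) ^ s)"
    proof -
      have "q powr (D * real s) * (1 - ?t) ^ card (between (fst x) (snd x)) \<le>
          (8 * real n) ^ s * exp (- c * p * real s) ^ s" if "x \<in> pairs" for x
      proof -
        have "card (between (fst x) (snd x)) = s * s"
          using that by (auto simp: pairs_def card_between)
        moreover have "(1 - ?t) ^ (s * s) \<le> exp (- ?t * real (s * s))"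
          by (rule power_one_minus_le_exp[OF t])
        moreover have "exp (- ?t * real (s * s)) = exp (- c * p * real s) ^ s"
          by (simp add: exp_of_nat_mult[symmetric] mult_ac)
        ultimately show ?thesis unfolding qDk by (intro mult_left_mono) auto
      qed
      then show ?thesis unfolding div_by_1 by (rule sum_mono)
    qed
    also have "\<dots> = real (card pairs) * y ^ s" by (simp add: y_def power_mult_distrib)
    also have "\<dots> \<le> real (n ^ s * n ^ s) * y ^ s"
    proof -
      have "pairs \<subseteq> {Z. Z \<subseteq> W \<and> card Z = s} \<times> {U. U \<subseteq> W \<and> card U = s}" by (auto simp: pairs_def)
      then have "card pairs \<le> card ({Z. Z \<subseteq> W \<and> card Z = s} \<times> {U. U \<subseteq> W \<and> card U = s})"
        using fin by (intro card_mono) auto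
      also have "\<dots> = (card W choose s) * (card W choose s)"
        using fin by (simp add: card_cartesian_product n_subsets)
      also have "\<dots> \<le> n ^ s * n ^ s"
      proof -
        have "card W choose s \<le> card W ^ s" using n cards by (intro binomial_le_pow) auto
        also have "\<dots> \<le> n ^ s" using n cards by (intro power_mono) auto
        finally show ?thesis by (intro mult_mono) auto
      qed
      finally show ?thesis using y by (intro mult_right_mono) (auto simp del: of_nat_mult of_nat_power)
    qed
    also have "\<dots> = \<rho> ^ s" by (simp add: \<rho>_y power_mult_distrib power2_eq_square)
    also have "\<dots> \<le> \<rho> ^ 1" using \<rho> s by (intro power_decreasing) (auto simp: \<rho>_def)
    finally show ?thesis by simp
  qed

  have bad3: "measure_pmf.prob ?M bad3 \<le> real n * 2 powr (- \<Delta>) * exp (4 * p * real s)"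
  proof -
    have "measure_pmf.prob ?M bad3 \<le>
        (\<Sum>v\<in>W. 2 powr (- \<Delta>) * (1 - p + p * 2) ^ card (between {v} R)) / 1"
      unfolding bad3_def
    proof (rule prob_random_graph_sum_ge[OF p])
      show "between {v} R \<subseteq> all_edges n" if "v \<in> W" for v
        using sub that by (intro between_subset_all_edges) auto
    qed auto
    also have "\<dots> \<le> (\<Sum>v\<in>W. 2 powr (- \<Delta>) * exp (4 * p * real s))"
    proof -
      have "(1 - p + p * 2) ^ card (between {v} R) \<le> exp (4 * p * real s)" if "v \<in> W" for v
      proof -
        have "card (between {v} R) = 4 * s" using that sub(4) cards by (subst card_between) auto
        moreover have "(1 + p) ^ (4 * s) \<le> exp p ^ (4 * s)"
          using p by (intro power_mono exp_ge_add_one_self) auto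
        ultimately show ?thesis by (simp add: exp_of_nat_mult[symmetric] mult_ac add_ac)
      qed
      then show ?thesis unfolding div_by_1 by (intro sum_mono mult_left_mono) auto
    qed
    also have "\<dots> = real (card W) * (2 powr (- \<Delta>) * exp (4 * p * real s))" by simp
    also have "\<dots> \<le> real n * (2 powr (- \<Delta>) * exp (4 * p * real s))"
      using n cards by (intro mult_right_mono) auto
    finally show ?thesis by simp
  qed

  let ?win = "{E. maker_wins_within 1 b E (perfect_matching_sets n E) (real n / 2 + 4 * real s * \<Delta>)}"
  have good: "E \<in> ?win" if E: "E \<subseteq> all_edges n" "E \<notin> bad1" "E \<notin> bad2" "E \<notin> bad3" for E
  proof -
    have finE: "finite E" using E(1) finite_all_edges finite_subset by blast
    define L where "L = nat \<lfloor>4 * real s * \<Delta>\<rfloor>"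
    have quot: "q powr (a - real k) = q powr a * (1 / q) ^ k" for a k
      using q(1) by (simp add: powr_diff powr_realpow power_one_over divide_inverse power_inverse)
    interpret matching_board E W R C s b L q D
    proof
      show "card e = 2" if "e \<in> E" for e using that E(1) by (auto simp: all_edges_def)
      show "card (E \<inter> between A R) \<le> L" if A: "A \<subseteq> W" "card A \<le> 4 * s" for A
      proof -
        have deg: "real (card (E \<inter> between {v} R)) \<le> \<Delta>" if v: "v \<in> W" for v
        proof -
          have "2 powr (- \<Delta>) * 2 ^ card (E \<inter> between {v} R) \<le>
              (\<Sum>v\<in>W. 2 powr (- \<Delta>) * 2 ^ card (E \<inter> between {v} R))"
            using fin v by (intro member_le_sum) auto
          also have "\<dots> < 1" using E(4) by (simp add: bad3_def)
          finally have "2 powr (real (card (E \<inter> between {v} R)) - \<Delta>) < 2 powr 0"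
            by (simp add: powr_diff powr_realpow powr_minus field_simps)
          then have "real (card (E \<inter> between {v} R)) - \<Delta> < 0"
            by (rule powr_less_cancel) simp
          then show ?thesis by simp
        qed
        have "real (card (E \<inter> between A R)) \<le> (\<Sum>v\<in>A. real (card (E \<inter> between {v} R)))"
          by (rule card_Int_between_le_sum[OF finite_subset[OF A(1) fin(2)]])
        also have "\<dots> \<le> (\<Sum>v\<in>A. \<Delta>)" using deg A by (intro sum_mono) auto
        also have "\<dots> \<le> 4 * real s * \<Delta>" using A(2) \<Delta> by (simp add: mult_right_mono)
        finally show ?thesis unfolding L_def by linarith
      qed
      show "\<exists>z\<in>Z. D \<le> real (card (E \<inter> between {z} U))"
        if ZU: "Z \<subseteq> W" "U \<subseteq> W" "Z \<inter> U = {}" "card Z = s" "card U = s" for Z U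
      proof (rule ccontr)
        assume none: "\<not> ?thesis"
        let ?h = "\<lambda>x. q powr (D * real s) * (1 / q) ^ card (E \<inter> between (fst x) (snd x))"
        have "(Z, U) \<in> pairs" using ZU by (simp add: pairs_def)
        moreover have "finite pairs"
          by (rule finite_subset[of _ "Pow W \<times> Pow W"]) (use fin in \<open>auto simp: pairs_def\<close>)
        ultimately have "?h (Z, U) \<le> sum ?h pairs"
          using q(1) by (intro member_le_sum) auto
        also have "sum ?h pairs < 1" using E(3) unfolding bad2_def by simp
        finally have "q powr (D * real s - real (card (E \<inter> between Z U))) < q powr 0"
          unfolding quot fst_conv snd_conv using q(1) by simp
        then have "D * real s - real (card (E \<inter> between Z U)) < 0"
          by (rule powr_less_cancel[OF _ q(1)])
        then have "D * real s < real (card (E \<inter> between Z U))" by simp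
        also have "\<dots> \<le> (\<Sum>z\<in>Z. real (card (E \<inter> between {z} U)))"
          by (rule card_Int_between_le_sum[OF finite_subset[OF ZU(1) fin(2)]])
        also have "\<dots> \<le> (\<Sum>z\<in>Z. D)" using none by (intro sum_mono) (simp add: not_le less_imp_le)
        finally show False using ZU by (simp add: mult.commute)
      qed
      have "real (card W) * q powr (- D) \<le> 1 / 8"
      proof -
        have "q powr (- D) = 1 / (8 * real n)" unfolding powr_minus_divide qD ..
        moreover have "real (card W) \<le> real n" using cards n by simp
        ultimately have "real (card W) * q powr (- D) \<le> real n * (1 / (8 * real n))"
          by (simp add: divide_right_mono)
        then show ?thesis using n(1) by simp
      qed
      moreover have "(\<Sum>(S, T)\<in>hall_pairs W R C s.
          q powr (D * card (S - C) - card (E \<inter> between S T))) < 3 / 8"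
        using E(2) unfolding bad1_def quot by (simp add: case_prod_unfold)
      ultimately show "real (card W) * q powr (- D) + (\<Sum>(S, T)\<in>hall_pairs W R C s.
          q powr (D * card (S - C) - card (E \<inter> between S T))) < 1 / 2" by linarith
    qed (use fin sub cards n q finE in \<open>auto simp: N_def\<close>)
    have "card W div 2 + 2 * s = n div 2" using cards n by (simp add: N_def)
    then have "matchings = perfect_matching_sets n E"
      by (simp add: matchings_def perfect_matching_sets_def)
    moreover have "real (card W) / 2 + real L \<le> real n / 2 + 4 * real s * \<Delta>"
    proof -
      have "real L \<le> 4 * real s * \<Delta>" using \<Delta> by (simp add: L_def)
      moreover have "real (card W) \<le> real n" using cards n by simp
      ultimately show ?thesis by simp
    qed
    ultimately show ?thesis using maker_wins maker_wins_within_mono by auto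
  qed
  have "measure_pmf.prob ?M (?win \<union> (bad1 \<union> (bad2 \<union> bad3))) = 1"
    by (rule measure_pmf.prob_eq_1[THEN iffD2])
      (use good in \<open>auto intro!: AE_pmfI dest: set_random_graph\<close>)
  moreover have "measure_pmf.prob ?M (?win \<union> (bad1 \<union> (bad2 \<union> bad3))) \<le>
      measure_pmf.prob ?M ?win + measure_pmf.prob ?M (bad1 \<union> (bad2 \<union> bad3))"
    by (rule measure_Un_le) auto
  moreover have "measure_pmf.prob ?M (bad1 \<union> (bad2 \<union> bad3)) \<le>
      measure_pmf.prob ?M bad1 + measure_pmf.prob ?M (bad2 \<union> bad3)"
    by (rule measure_Un_le) auto
  moreover have "measure_pmf.prob ?M (bad2 \<union> bad3) \<le>
      measure_pmf.prob ?M bad2 + measure_pmf.prob ?M bad3"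
    by (rule measure_Un_le) auto
  ultimately show ?thesis using bad1 bad2 bad3 by linarith
qed

section \<open>Asymptotics\<close>

theorem theorem1p1:
  fixes b :: nat and K :: real
  assumes "b \<ge> 1" and "K > 12"
  shows "\<exists>g :: nat \<Rightarrow> real. (\<lambda>n. g n / real n) \<longlonglongrightarrow> 0 \<and>
    (\<lambda>n. measure_pmf.prob (random_graph n (ln (real n) powr K / real n))
           {E. maker_wins_within 1 b E (perfect_matching_sets n E) (real n / 2 + g n)})
      \<longlonglongrightarrow> 1"
proof -
  \<comment> \<open>The reserve is chosen such that \<open>p s\<close> is about \<open>(ln n)\<^sup>2\<close>. Then \<open>e\<^bsup>-cps\<^esup>\<close> beats every power of
    \<open>n\<close>, while \<open>s (ln n)\<^sup>2\<close> is still \<open>o(n)\<close>.\<close>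
  define p where "p n = ln (real n) powr K / real n" for n
  define u where "u n = real n / ln (real n) powr (K - 2)" for n
  define s where "s n = nat \<lfloor>u n\<rfloor>" for n
  define \<Delta> where "\<Delta> n = 8 * ln (real n) ^ 2" for n
  define g where "g n = 4 * real (s n) * \<Delta> n" for n
  define c where "c = 1 / (4 * real b + 1)"
  define \<epsilon> where "\<epsilon> n = 8 * real n ^ 3 * exp (- (c / 2) * ln (real n) ^ 2)" for n
  let ?err = "\<lambda>n. 6 * real n * \<epsilon> n + \<epsilon> n +
    real n * exp (- (ln (real n) ^ 2))"
  let ?prob = "\<lambda>n. measure_pmf.prob (random_graph n (p n))
    {E. maker_wins_within 1 b E (perfect_matching_sets n E) (real n / 2 + g n)}"
  have c: "0 < c" by (simp add: c_def)
  have poly_log: "(\<lambda>n. ln (real n) powr a / real n) \<longlonglongrightarrow> 0" for a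
    by real_asymp
  have ln_large: "eventually (\<lambda>n. 16 \<le> ln (real n)) sequentially"
    by real_asymp
  have p_small: "eventually (\<lambda>n. p n < 1) sequentially"
    unfolding p_def by (rule order_tendstoD(2)[OF poly_log]) simp
  have u_large: "eventually (\<lambda>n. ln (real n) powr (K - 2) / real n < 1 / 2) sequentially"
    by (rule order_tendstoD(2)[OF poly_log]) simp
  have \<epsilon>_small: "eventually (\<lambda>n. \<epsilon> n < 1) sequentially"
  proof (rule order_tendstoD(2))
    show "\<epsilon> \<longlonglongrightarrow> 0" unfolding \<epsilon>_def using c by real_asymp
  qed simp
  have err: "?err \<longlonglongrightarrow> 0"
  proof -
    have "(\<lambda>n. 6 * real n * \<epsilon> n) \<longlonglongrightarrow> 0" "\<epsilon> \<longlonglongrightarrow> 0"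
      unfolding \<epsilon>_def using c by real_asymp+
    moreover have "(\<lambda>n. real n * exp (- (ln (real n) ^ 2))) \<longlonglongrightarrow> 0"
      by real_asymp
    ultimately show ?thesis by (intro tendsto_add_zero)
  qed
  have sizes: "1 \<le> s n \<and> real (s n) \<le> u n \<and> 8 * s n < n \<and>
      ln (real n) ^ 2 / 2 \<le> p n * real (s n) \<and> p n * real (s n) \<le> ln (real n) ^ 2"
    if l: "16 \<le> ln (real n)" and u: "ln (real n) powr (K - 2) / real n < 1 / 2" for n
  proof -
    have n: "0 < n" using l by (intro Nat.gr0I) auto
    have pow: "16 \<le> ln (real n) powr (K - 2)"
    proof -
      have "ln (real n) powr 1 \<le> ln (real n) powr (K - 2)"
        using l assms(2) by (intro powr_mono) auto
      then show ?thesis using l by simp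
    qed
    have u2: "2 \<le> u n" using u n pow unfolding u_def by (simp add: field_simps)
    have u16: "16 * u n \<le> real n"
    proof -
      have "0 < ln (real n) powr (K - 2)" using pow by linarith
      then show ?thesis using mult_left_mono[OF pow, of "real n"]
        by (simp add: u_def pos_divide_le_eq mult.commute)
    qed
    have s_le: "real (s n) \<le> u n" and s_ge: "u n / 2 \<le> real (s n)"
      using u2 unfolding s_def by linarith+
    have pu: "p n * u n = ln (real n) ^ 2"
    proof -
      have "ln (real n) powr K = ln (real n) powr (K - 2) * ln (real n) powr 2"
        by (simp add: powr_add[symmetric])
      then have "ln (real n) powr K = ln (real n) powr (K - 2) * ln (real n) ^ 2"
        using l by simp
      then show ?thesis using n pow unfolding p_def u_def by simp
    qed
    have p0: "0 \<le> p n" by (simp add: p_def)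
    have "p n * (u n / 2) \<le> p n * real (s n)" "p n * real (s n) \<le> p n * u n"
      by (intro mult_left_mono s_ge s_le p0)+
    moreover have "real (8 * s n) < real n" using s_le u16 u2 by simp
    then have "8 * s n < n" by linarith
    moreover have "1 \<le> s n" using s_ge u2 by linarith
    ultimately show ?thesis using s_le pu by simp
  qed
  have "(\<lambda>n. g n / real n) \<longlonglongrightarrow> 0"
  proof (rule tendsto_sandwich[where f = "\<lambda>_. 0"])
    show "(\<lambda>n. 32 * ln (real n) powr (4 - K)) \<longlonglongrightarrow> 0"
    proof -
      have "filterlim (\<lambda>n. ln (real n)) at_top sequentially" by real_asymp
      then have "(\<lambda>n. ln (real n) powr (4 - K)) \<longlonglongrightarrow> 0"
        using assms(2) by (intro tendsto_neg_powr) auto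
      from tendsto_mult_left[OF this, of 32] show ?thesis by simp
    qed
    show "eventually (\<lambda>n. g n / real n \<le> 32 * ln (real n) powr (4 - K)) sequentially"
      using ln_large u_large
    proof eventually_elim
      case (elim n)
      have n: "0 < n" using elim(1) by (intro Nat.gr0I) auto
      have "g n = 32 * ln (real n) ^ 2 * real (s n)" by (simp add: g_def \<Delta>_def)
      also have "\<dots> \<le> 32 * ln (real n) ^ 2 * u n"
        using sizes[OF elim] by (intro mult_left_mono) auto
      also have "\<dots> = real n * (32 * (ln (real n) powr 2 / ln (real n) powr (K - 2)))"
        using elim(1) by (simp add: u_def)
      also have "\<dots> = real n * (32 * ln (real n) powr (4 - K))"
        by (simp add: powr_diff[symmetric])
      finally show ?case using n by (simp add: field_simps)
    qed
  qed (auto simp: g_def \<Delta>_def)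
  moreover have "?prob \<longlonglongrightarrow> 1"
  proof (rule tendsto_sandwich[where h = "\<lambda>_. 1"])
    show "(\<lambda>n. 1 - ?err n) \<longlonglongrightarrow> 1"
      using tendsto_diff[OF tendsto_const err, of 1] by simp
    show "eventually (\<lambda>n. 1 - ?err n \<le> ?prob n) sequentially"
      using ln_large u_large p_small \<epsilon>_small
    proof eventually_elim
      case (elim n)
      note sz = sizes[OF elim(1,2)]
      define \<rho> where "\<rho> = 8 * real n ^ 3 * exp (- c * p n * real (s n))"
      have \<rho>: "\<rho> \<le> \<epsilon> n"
      proof -
        have "c * (ln (real n) ^ 2 / 2) \<le> c * (p n * real (s n))"
          using sz c by (intro mult_left_mono) auto
        then show ?thesis unfolding \<rho>_def \<epsilon>_def by (intro mult_left_mono) (auto simp: mult_ac)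
      qed
      have "1 - (6 * real n * \<rho> + \<rho> + real n * 2 powr (- \<Delta> n) * exp (4 * p n * real (s n))) \<le> ?prob n"
        unfolding g_def \<rho>_def c_def
        by (rule prob_maker_wins_ge)
          (use assms elim sz \<rho> in \<open>auto simp: p_def \<Delta>_def \<rho>_def c_def\<close>)
      moreover have "6 * real n * \<rho> \<le> 6 * real n * \<epsilon> n"
        using \<rho> by (intro mult_left_mono) auto
      moreover have "real n * 2 powr (- \<Delta> n) * exp (4 * p n * real (s n)) \<le>
          real n * exp (- (ln (real n) ^ 2))"
      proof -
        \<comment> \<open>The constant \<open>8\<close> in \<open>\<Delta>\<close> is large enough as \<open>8 ln 2 > 5\<close>.\<close>
        have "2 powr (- \<Delta> n) * exp (4 * p n * real (s n)) =
            exp (4 * (p n * real (s n)) - 8 * ln 2 * ln (real n) ^ 2)"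
          by (simp add: powr_def \<Delta>_def exp_add[symmetric] algebra_simps)
        also have "\<dots> \<le> exp (- (ln (real n) ^ 2))"
        proof -
          have "5 * ln (real n) ^ 2 \<le> 8 * ln 2 * ln (real n) ^ 2"
            using ln2_ge_two_thirds by (intro mult_right_mono) auto
          moreover have "p n * real (s n) \<le> ln (real n) ^ 2" using sz by blast
          ultimately show ?thesis unfolding exp_le_cancel_iff by linarith
        qed
        finally show ?thesis unfolding mult.assoc by (rule mult_left_mono) simp
      qed
      ultimately show ?case using \<rho> by linarith
    qed
  qed auto
  ultimately show ?thesis unfolding p_def by blast
qed

end
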